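(* Let $c>0$, $\lambda>0$, $t>0$, and let $\underline{\mathbf X}_d(t)$, $\underline{\mathbf Y}_d(t)$ be the random flights with random number of changes of direction $\mathcal{N}_d(t)$, respectively $\mathcal{M}_d(t)$, defined in the context. (i) For every integer $d\ge2$, the absolutely continuous component of the probability distribution of $\underline{\mathbf X}_d(t)$ has density $$\frac{P\{\underline{\mathbf X}_{d}(t)\in d\underline{\mathbf x}_{d}\}}{\prod_{j=1}^ddx_j}=\frac{\lambda t}{\pi^{\frac d2}}\frac{(c^2t^2-\|\underline{\mathbf x}_{d}\|^2)^{\frac{d-1}{2}-1}}{(ct)^{2(d-1)-1}}\,\frac{E_{\frac {d-1}{2},\frac {d-1}{2}}\left(\frac{\lambda t(c^2t^2-\|\underline{\mathbf x}_{d}\|^2)^{\frac {d-1}{2}}}{(ct)^{d-1}}\right)}{E_{\frac{d-1}{2},\frac d2}(\lambda t)},\qquad \|\underline{\mathbf x}_d\|<ct.$$ (ii) For every integer $d\ge3$, the absolutely continuous component of the probability distribution of $\underline{\mathbf Y}_d(t)$ has density $$\frac{P\{\underline{\mathbf Y}_{d}(t)\in d\underline{\mathbf y}_{d}\}}{\prod_{j=1}^ddy_j}=\frac{\lambda t}{\pi^{\frac d2}}\frac{(c^2t^2-\|\underline{\mathbf y}_{d}\|^2)^{\frac{d}{2}-2}}{(ct)^{4(\frac d2-1)}}\,\frac{E_{\frac {d}{2}-1,\frac {d}{2}-1}\left(\frac{\lambda t(c^2t^2-\|\underline{\mathbf y}_{d}\|^2)^{\frac {d}{2}-1}}{(ct)^{d-2}}\right)}{E_{\frac{d}{2}-1,\frac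 d2}(\lambda t)},\qquad \|\underline{\mathbf y}_d\|<ct.$$
   Context: $\|\cdot\|$ is the Euclidean norm on $\mathbb{R}^d$. $E_{\alpha,\beta}(x)=\sum_{k=0}^\infty\frac{x^k}{\Gamma(\alpha k+\beta)}$ ($x\in\mathbb{R}$, $\alpha,\beta>0$) is the generalized Mittag-Leffler function. Random flights with a fixed number $n\ge0$ of changes of direction. Fix $c>0$ (speed), $t>0$. Let $V_1,\dots,V_{n+1}$ be independent random vectors uniformly distributed on the unit sphere of $\mathbb{R}^d$. For $n\ge1$ let $(\tau_1,\dots,\tau_n)$ be a random vector independent of the $V_j$'s, with $\tau_j>0$, $\sum_{j=1}^n\tau_j<t$, and put $\tau_{n+1}=t-\sum_{j=1}^n\tau_j$; for $n=0$ put $\tau_1=t$. The position at time $t$ is $c\sum_{j=1}^{n+1}\tau_jV_j$ (so for $n=0$ it is uniformly distributed on the sphere of radius $ct$). In the first model ($d\ge2$), for $n\ge1$, $(\tau_1,\dots,\tau_n)$ has density $$f_1(\tau_1,\dots,\tau_n)=\frac{\Gamma((n+1)(d-1))}{(\Gamma(d-1))^{n+1}}\frac{1}{t^{(n+1)(d-1)-1}}\prod_{j=1}^{n+1}\tau_j^{d-2}$$ on $\{\tau_j>0,\ \sum_{j=1}^n\tau_j<t\}$. In the second model ($d\ge3$), for $n\ge1$, it has density $$f_2(\tau_1,\dots,\tau_n)=\frac{\Gamma((n+1)(\frac d2-1))}{(\Gamma(\frac d2-1))^{n+1}}\frac{1}{t^{(n+1)(\frac d2-1)-1}}\prod_{j=1}^{n+1}\tau_j^{\frac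 d2-2}$$ on the same set. Randomized number of changes of direction. $\underline{\mathbf X}_d(t)$ is the random vector whose conditional law given $\mathcal{N}_d(t)=n$ is the law of the position at time $t$ in the first model with $n$ changes of direction, where $\mathcal{N}_d(t)$ (independent of the displacements and orientations) has the distribution (fractional Poisson process) $$P\{\mathcal{N}_d(t)=n\}=\frac{1}{E_{\frac{d-1}{2},\frac d2}(\lambda t)}\frac{(\lambda t)^n}{\Gamma(\frac{d-1}{2}n+\frac d2)},\qquad n=0,1,\dots$$ $\underline{\mathbf Y}_d(t)$ is the random vector whose conditional law given $\mathcal{M}_d(t)=n$ is the law of the position at time $t$ in the second model with $n$ changes of direction, where $\mathcal{M}_d(t)$ (independent of the displacements and orientations) has the distribution $$P\{\mathcal{M}_d(t)=n\}=\frac{1}{E_{\frac{d}{2}-1,\frac d2}(\lambda t)}\frac{(\lambda t)^n}{\Gamma((\frac{d}{2}-1)n+\frac d2)},\qquad n=0,1,\dots$$ *)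

theory Defs
  imports "HOL-Probability.Probability"
begin

definition mittag_leffler :: "real \<Rightarrow> real \<Rightarrow> real \<Rightarrow> real" where
  "mittag_leffler \<alpha> \<beta> x = (\<Sum>k. x ^ k / Gamma (\<alpha> * real k + \<beta>))"


text \<open>
  The uniform distribution on the unit sphere, i.e. normalised surface measure, realised as the
  cone measure: the law of the direction of a uniformly distributed point of the unit ball.
  (The value \<open>sgn 0 = 0\<close> only matters on a null set.) It is a rotation invariant probability
  measure carried by the sphere, see below.
\<close>

definition uniform_sphere :: "(real ^ 'd) measure" where
  "uniform_sphere = distr (uniform_measure lborel (ball 0 1)) borel sgn"

lemma sets_uniform_sphere [simp, measurable_cong]: "sets uniform_sphere = sets borel"
  by (simp add: uniform_sphere_def)

lemma space_uniform_sphere [simp]: "space uniform_sphere = UNIV"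
  by (simp add: uniform_sphere_def)

lemma measurable_sgn_vec [measurable]: "(sgn :: real ^ 'd \<Rightarrow> real ^ 'd) \<in> borel_measurable borel"
  unfolding sgn_div_norm by measurable

lemma emeasure_unit_ball:
  "emeasure lborel (ball 0 1 :: (real ^ 'd) set) \<noteq> 0"
  "emeasure lborel (ball 0 1 :: (real ^ 'd) set) \<noteq> \<infinity>"
proof -
  show "emeasure lborel (ball 0 1 :: (real ^ 'd) set) \<noteq> \<infinity>"
    using emeasure_lborel_ball_finite[of "0 :: real ^ 'd" 1] by simp
  show "emeasure lborel (ball 0 1 :: (real ^ 'd) set) \<noteq> 0"
    using content_ball_pos[of 1 "0 :: real ^ 'd"] by (auto simp: measure_def)
qed

lemma prob_space_uniform_sphere: "prob_space (uniform_sphere :: (real ^ 'd) measure)"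
  unfolding uniform_sphere_def
  by (intro prob_space.prob_space_distr prob_space_uniform_measure emeasure_unit_ball) auto

lemma emeasure_uniform_sphere:
  fixes A :: "(real ^ 'd) set"
  assumes "A \<in> sets borel"
  shows "emeasure uniform_sphere A =
    emeasure lborel (ball 0 1 \<inter> sgn -` A) / emeasure lborel (ball 0 1 :: (real ^ 'd) set)"
  using assms measurable_sets[OF measurable_sgn_vec, of A] unfolding uniform_sphere_def
  by (subst emeasure_distr) auto

lemma AE_uniform_sphere: "AE v in (uniform_sphere :: (real ^ 'd) measure). norm v = 1"
proof -
  have "AE x in (lborel :: (real ^ 'd) measure). x \<noteq> 0"
    by (rule AE_lborel_singleton)
  then have "AE x in uniform_measure lborel (ball 0 1 :: (real ^ 'd) set). norm (sgn x) = 1"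
    by (intro AE_uniform_measureI) (auto simp: norm_sgn elim: eventually_mono)
  then show ?thesis
    unfolding uniform_sphere_def by (subst AE_distr_iff) auto
qed

lemma distr_lborel_orthogonal:
  fixes f :: "real ^ 'd \<Rightarrow> real ^ 'd"
  assumes f: "orthogonal_transformation f"
  shows "distr lborel borel f = lborel"
proof (rule measure_eqI)
  have lin: "linear f" using f by (rule orthogonal_transformation_linear)
  have fm [measurable]: "f \<in> borel_measurable borel"
    by (intro borel_measurable_continuous_onI linear_continuous_on linear_conv_bounded_linear[THEN iffD1] lin)
  have nf: "norm (f x) = norm x" for x
    using f by (rule orthogonal_transformation_norm)
  have surj: "surj f" using f by (rule orthogonal_transformation_surj)
  let ?B = "ball 0 1 :: (real ^ 'd) set"
  let ?\<mu> = "distr lborel borel f"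
  have B [measurable]: "?B \<in> sets borel" by simp
  have fB: "f -` cball 0 r = cball 0 r" for r
    by (auto simp: nf)
  have fB': "f -` ?B = ?B"
    by (auto simp: nf)
  have shift: "(\<integral>\<^sup>+y. h (a + y) \<partial>lborel) = (\<integral>\<^sup>+y. h y \<partial>lborel)"
    if [measurable]: "h \<in> borel_measurable borel" for h :: "real ^ 'd \<Rightarrow> ennreal" and a
  proof -
    have "(\<integral>\<^sup>+y. h y \<partial>lborel) = (\<integral>\<^sup>+y. h y \<partial>distr lborel borel ((+) a))"
      by (simp add: lborel_distr_plus)
    then show ?thesis by (simp add: nn_integral_distr)
  qed
  have reflect: "(\<integral>\<^sup>+y. h (a - y) \<partial>lborel) = (\<integral>\<^sup>+y. h y \<partial>lborel)"
    if [measurable]: "h \<in> borel_measurable borel" for h :: "real ^ 'd \<Rightarrow> ennreal" and a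
  proof -
    have "(\<integral>\<^sup>+y. h y \<partial>lborel) =
        (\<integral>\<^sup>+y. h y \<partial>density (distr lborel borel (\<lambda>x. a - x)) (\<lambda>_. 1))"
      using lborel_affine[of "-1" a] by simp
    then show ?thesis by (simp add: nn_integral_distr density_1)
  qed
  have shift': "(\<integral>\<^sup>+y. h (y - a) \<partial>?\<mu>) = (\<integral>\<^sup>+y. h y \<partial>?\<mu>)"
    if [measurable]: "h \<in> borel_measurable borel" for h :: "real ^ 'd \<Rightarrow> ennreal" and a
  proof -
    obtain b where b: "f b = - a" using surj by (metis surj_def)
    have "f y - a = f (b + y)" for y
      using b by (simp add: linear_add[OF lin])
    then show ?thesis
      using shift[of "\<lambda>y. h (f y)" b] by (simp add: nn_integral_distr)
  qed
  interpret \<mu>: sigma_finite_measure ?\<mu>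
  proof
    show "\<exists>A. countable A \<and> A \<subseteq> sets ?\<mu> \<and> \<Union> A = space ?\<mu> \<and> (\<forall>a\<in>A. emeasure ?\<mu> a \<noteq> \<infinity>)"
    proof (intro exI[of _ "range (\<lambda>n. cball 0 (real n))"] conjI ballI)
      show "\<Union> (range (\<lambda>n. cball (0 :: real ^ 'd) (real n))) = space ?\<mu>"
        by (auto simp: real_arch_simple)
      fix a assume "a \<in> range (\<lambda>n. cball (0 :: real ^ 'd) (real n))"
      then show "emeasure ?\<mu> a \<noteq> \<infinity>"
        using emeasure_lborel_cball_finite[of "0 :: real ^ 'd"]
        by (auto simp: emeasure_distr fB less_top[symmetric] top_unique)
    qed auto
  qed
  interpret pair_sigma_finite lborel ?\<mu> ..
  fix A assume "A \<in> sets ?\<mu>"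
  then have A [measurable]: "A \<in> sets borel" by simp
  have "emeasure lborel A * emeasure ?\<mu> ?B =
      (\<integral>\<^sup>+x. indicator A x * (\<integral>\<^sup>+y. indicator ?B (y - x) \<partial>?\<mu>) \<partial>lborel)"
    by (subst shift') (auto simp: nn_integral_multc intro!: borel_measurable_indicator)
  also have "\<dots> = (\<integral>\<^sup>+x. (\<integral>\<^sup>+y. indicator A x * indicator ?B (y - x) \<partial>?\<mu>) \<partial>lborel)"
    by (simp add: nn_integral_cmult)
  also have "\<dots> = (\<integral>\<^sup>+y. (\<integral>\<^sup>+x. indicator A x * indicator ?B (y - x) \<partial>lborel) \<partial>?\<mu>)"
    by (rule Fubini'[symmetric]) measurable
  also have "\<dots> = (\<integral>\<^sup>+y. (\<integral>\<^sup>+x. indicator A (y - x) * indicator ?B x \<partial>lborel) \<partial>?\<mu>)"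
  proof (rule nn_integral_cong)
    fix y :: "real ^ 'd"
    show "(\<integral>\<^sup>+x. indicator A x * indicator ?B (y - x) \<partial>lborel) =
        (\<integral>\<^sup>+x. indicator A (y - x) * indicator ?B x \<partial>lborel)"
      using reflect[of "\<lambda>x. indicator A (y - x) * indicator ?B x" y] by simp
  qed
  also have "\<dots> = (\<integral>\<^sup>+x. (\<integral>\<^sup>+y. indicator A (y - x) * indicator ?B x \<partial>?\<mu>) \<partial>lborel)"
    by (rule Fubini') measurable
  also have "\<dots> = (\<integral>\<^sup>+x. (\<integral>\<^sup>+y. indicator A (y - x) \<partial>?\<mu>) * indicator ?B x \<partial>lborel)"
    by (simp add: nn_integral_multc)
  also have "\<dots> = emeasure ?\<mu> A * emeasure lborel ?B"
    by (subst shift') (auto simp: nn_integral_cmult intro!: borel_measurable_indicator)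
  finally have "emeasure lborel A * emeasure lborel ?B = emeasure ?\<mu> A * emeasure lborel ?B"
    by (simp add: emeasure_distr fB')
  then show "emeasure ?\<mu> A = emeasure lborel A"
    using emeasure_unit_ball[where 'd='d]
    by (metis ennreal_mult_divide_eq infinity_ennreal_def)
qed simp

lemma uniform_sphere_rotation_invariant:
  fixes f :: "real ^ 'd \<Rightarrow> real ^ 'd"
  assumes f: "orthogonal_transformation f"
  shows "distr uniform_sphere borel f = uniform_sphere"
proof (rule measure_eqI)
  fix A :: "(real ^ 'd) set"
  assume "A \<in> sets (distr uniform_sphere borel f)"
  then have A: "A \<in> sets borel" by simp
  have lin: "linear f" using f by (rule orthogonal_transformation_linear)
  have fm [measurable]: "f \<in> borel_measurable borel"
    by (intro borel_measurable_continuous_onI linear_continuous_on linear_conv_bounded_linear[THEN iffD1] lin)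
  have fA: "f -` A \<in> sets borel" using measurable_sets[OF fm A] by simp
  let ?S = "ball 0 1 \<inter> sgn -` A" and ?T = "ball 0 1 \<inter> sgn -` (f -` A)"
  have S: "?S \<in> sets borel" using measurable_sets[OF measurable_sgn_vec A] by auto
  have nf: "norm (f x) = norm x" for x
    using f by (rule orthogonal_transformation_norm)
  have "sgn (f x) = f (sgn x)" for x
    by (simp add: sgn_div_norm nf linear_cmul[OF lin])
  then have "?T = f -` ?S"
    by (auto simp: nf)
  moreover have "emeasure lborel ?S = emeasure (distr lborel borel f) ?S"
    by (simp add: distr_lborel_orthogonal[OF f])
  ultimately have "emeasure lborel ?S = emeasure lborel ?T"
    using S by (simp add: emeasure_distr)
  then show "emeasure (distr uniform_sphere borel f) A = emeasure uniform_sphere A"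
    using A fA by (simp add: emeasure_distr emeasure_uniform_sphere)
qed simp


text \<open>
  Durations \<open>\<tau> 1, \<dots>, \<tau> n\<close> of the first \<open>n\<close> displacements are functions on \<open>{1..n}\<close>; the last
  duration is what remains of the time \<open>t\<close>. The joint density is that of the Dirichlet law with
  all parameters equal to \<open>a\<close>, rescaled to total length \<open>t\<close>: the value \<open>a = d - 1\<close> gives the first
  model and \<open>a = d/2 - 1\<close> the second one.
\<close>

definition duration :: "real \<Rightarrow> nat \<Rightarrow> (nat \<Rightarrow> real) \<Rightarrow> nat \<Rightarrow> real" where
  "duration t n \<tau> j = (if j \<le> n then \<tau> j else t - (\<Sum>i\<in>{1..n}. \<tau> i))"

definition durations_density :: "real \<Rightarrow> real \<Rightarrow> nat \<Rightarrow> (nat \<Rightarrow> real) \<Rightarrow> real" where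
  "durations_density a t n \<tau> =
    (if (\<forall>j\<in>{1..n}. \<tau> j > 0) \<and> (\<Sum>j\<in>{1..n}. \<tau> j) < t
     then Gamma ((real n + 1) * a) / Gamma a ^ (n + 1) *
          (1 / t powr ((real n + 1) * a - 1)) *
          (\<Prod>j\<in>{1..n+1}. duration t n \<tau> j powr (a - 1))
     else 0)"

lemma measurable_duration:
  assumes "j \<in> {1..n+1}"
  shows "(\<lambda>\<tau>. duration t n \<tau> j) \<in> borel_measurable (\<Pi>\<^sub>M j\<in>{1..n}. lborel)"
proof (cases "j \<le> n")
  case True
  then show ?thesis
    using assms by (auto simp: duration_def intro!: measurable_component_singleton[THEN measurable_compose])
next
  case False
  then show ?thesis
    by (auto simp: duration_def intro!: borel_measurable_diff borel_measurable_sum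
        measurable_component_singleton[THEN measurable_compose])
qed

lemma measurable_durations_density [measurable]:
  "durations_density a t n \<in> borel_measurable (\<Pi>\<^sub>M j\<in>{1..n}. lborel)"
proof -
  let ?M = "\<Pi>\<^sub>M j\<in>{1..n}. (lborel :: real measure)"
  have comp: "(\<lambda>\<tau>. \<tau> j) \<in> borel_measurable ?M" if "j \<in> {1..n}" for j
    using that by (auto intro!: measurable_component_singleton[THEN measurable_compose])
  have "Measurable.pred ?M (\<lambda>\<tau>. (\<forall>j\<in>{1..n}. \<tau> j > 0) \<and> (\<Sum>j\<in>{1..n}. \<tau> j) < t)"
    by (intro pred_intros_logic pred_intros_finite borel_measurable_pred_less
        borel_measurable_sum borel_measurable_const comp finite_atLeastAtMost) auto
  moreover have "(\<lambda>\<tau>. duration t n \<tau> j powr (a - 1)) \<in> borel_measurable ?M" if "j \<in> {1..n+1}" for j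
    using measurable_duration[OF that] by measurable
  ultimately show ?thesis
    unfolding durations_density_def
    by (intro measurable_If borel_measurable_times borel_measurable_const borel_measurable_prod) auto
qed

definition durations_law :: "real \<Rightarrow> real \<Rightarrow> nat \<Rightarrow> (nat \<Rightarrow> real) measure" where
  "durations_law a t n =
    density (\<Pi>\<^sub>M j\<in>{1..n}. lborel) (\<lambda>\<tau>. ennreal (durations_density a t n \<tau>))"

text \<open>
  For \<open>n = 0\<close> the base measure is the unit point mass on the one-point space of functions on
  \<open>{}\<close> and the density is 1, so that the only displacement lasts exactly the time \<open>t\<close>.
\<close>

lemma durations_law_0:
  assumes "a > 0" "t > 0"
  shows "durations_law a t 0 = (\<Pi>\<^sub>M j\<in>{}. lborel)"
    and "duration t 0 \<tau> 1 = t"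
proof -
  have "Gamma a > 0" using assms by (intro Gamma_real_pos)
  then have "Gamma a \<noteq> 0" by simp
  then have "durations_density a t 0 \<tau> = 1" for \<tau>
    using assms by (simp add: durations_density_def duration_def)
  then show "durations_law a t 0 = (\<Pi>\<^sub>M j\<in>{}. lborel)"
    by (simp add: durations_law_def density_1)
  show "duration t 0 \<tau> 1 = t" by (simp add: duration_def)
qed

definition flight_position ::
    "real \<Rightarrow> real \<Rightarrow> nat \<Rightarrow> (nat \<Rightarrow> real) \<Rightarrow> (nat \<Rightarrow> real ^ 'd) \<Rightarrow> real ^ 'd" where
  "flight_position c t n \<tau> v = c *\<^sub>R (\<Sum>j\<in>{1..n+1}. duration t n \<tau> j *\<^sub>R v j)"

lemma measurable_flight_position:
  "(\<lambda>(\<tau>, v). flight_position c t n \<tau> v :: real ^ 'd) \<in>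
     borel_measurable (durations_law a t n \<Otimes>\<^sub>M (\<Pi>\<^sub>M j\<in>{1..n+1}. uniform_sphere))"
proof -
  have 1: "(\<lambda>p. duration t n (fst p) j) \<in>
      borel_measurable (durations_law a t n \<Otimes>\<^sub>M (\<Pi>\<^sub>M j\<in>{1..n+1}. (uniform_sphere :: (real ^ 'd) measure)))"
    if "j \<in> {1..n+1}" for j
    using measurable_duration[OF that]
    by (intro measurable_compose[OF measurable_fst]) (simp add: durations_law_def)
  have 2: "(\<lambda>p. snd p j) \<in>
      borel_measurable (durations_law a t n \<Otimes>\<^sub>M (\<Pi>\<^sub>M j\<in>{1..n+1}. (uniform_sphere :: (real ^ 'd) measure)))"
    if "j \<in> {1..n+1}" for j
    using measurable_component_singleton[OF that, of "\<lambda>_. uniform_sphere :: (real ^ 'd) measure"]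
    by (intro measurable_compose[OF measurable_snd]) (simp cong: measurable_cong_sets)
  show ?thesis
    unfolding flight_position_def case_prod_beta
    by (intro borel_measurable_scaleR borel_measurable_const borel_measurable_sum 1 2) auto
qed

text \<open>The product measure expresses the independence of all \<open>v j\<close> and of the vector \<open>\<tau>\<close>.\<close>

definition flight_law :: "real \<Rightarrow> real \<Rightarrow> real \<Rightarrow> nat \<Rightarrow> (real ^ 'd) measure" where
  "flight_law a c t n =
    distr (durations_law a t n \<Otimes>\<^sub>M (\<Pi>\<^sub>M j\<in>{1..n+1}. uniform_sphere)) borel
      (\<lambda>(\<tau>, v). flight_position c t n \<tau> v)"

definition first_flight_law :: "real \<Rightarrow> real \<Rightarrow> nat \<Rightarrow> (real ^ 'd) measure" where
  "first_flight_law = flight_law (real CARD('d) - 1)"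

definition second_flight_law :: "real \<Rightarrow> real \<Rightarrow> nat \<Rightarrow> (real ^ 'd) measure" where
  "second_flight_law = flight_law (real CARD('d) / 2 - 1)"


definition fractional_poisson_prob :: "real \<Rightarrow> real \<Rightarrow> real \<Rightarrow> nat \<Rightarrow> real" where
  "fractional_poisson_prob \<alpha> \<beta> x n =
    1 / mittag_leffler \<alpha> \<beta> x * (x ^ n / Gamma (\<alpha> * real n + \<beta>))"

text \<open>
  \<open>X\<close> is a random vector on \<open>M\<close> with conditional law \<open>L n\<close> given \<open>N = n\<close>, where \<open>N\<close> takes the
  value \<open>n\<close> with probability \<open>p n\<close>.
\<close>

definition randomized_flight ::
    "'w measure \<Rightarrow> ('w \<Rightarrow> nat) \<Rightarrow> ('w \<Rightarrow> real ^ 'd) \<Rightarrow> (nat \<Rightarrow> real) \<Rightarrow>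
     (nat \<Rightarrow> (real ^ 'd) measure) \<Rightarrow> bool" where
  "randomized_flight M N X p L \<longleftrightarrow>
    prob_space M \<and> N \<in> measurable M (count_space UNIV) \<and> X \<in> borel_measurable M \<and>
    (\<forall>n. \<P>(\<omega> in M. N \<omega> = n) = p n) \<and>
    (\<forall>n. \<forall>A\<in>sets borel. \<P>(\<omega> in M. X \<omega> \<in> A \<bar> N \<omega> = n) = measure (L n) A)"


definition mutually_singular :: "'a measure \<Rightarrow> 'a measure \<Rightarrow> bool" where
  "mutually_singular M S \<longleftrightarrow>
    sets S = sets M \<and> (\<exists>Z\<in>sets M. emeasure M Z = 0 \<and> emeasure S (space M - Z) = 0)"

text \<open>\<open>A\<close> is the absolutely continuous component of \<open>N\<close> in its Lebesgue decomposition
  with respect to \<open>M\<close>.\<close>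

definition ac_component :: "'a measure \<Rightarrow> 'a measure \<Rightarrow> 'a measure \<Rightarrow> bool" where
  "ac_component M N A \<longleftrightarrow>
    sets N = sets M \<and> sets A = sets M \<and> absolutely_continuous M A \<and>
    (\<exists>S. mutually_singular M S \<and>
         (\<forall>B\<in>sets M. emeasure N B = emeasure A B + emeasure S B))"

lemma ac_component_unique:
  assumes "ac_component M N A1" "ac_component M N A2"
  shows "A1 = A2"
proof -
  have *: "\<exists>Z\<in>null_sets M. \<forall>B\<in>sets M. \<forall>Z'\<in>null_sets M. Z \<subseteq> Z' \<longrightarrow>
      emeasure A B = emeasure N (B - Z')" if ac: "ac_component M N A" for A
  proof -
    from ac obtain S Z where S: "sets S = sets M" "sets A = sets M" "absolutely_continuous M A"
      "\<And>B. B \<in> sets M \<Longrightarrow> emeasure N B = emeasure A B + emeasure S B"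
      and Z: "Z \<in> sets M" "emeasure M Z = 0" "emeasure S (space M - Z) = 0"
      unfolding ac_component_def mutually_singular_def by blast
    have "emeasure A B = emeasure N (B - Z')"
      if B: "B \<in> sets M" and Z': "Z' \<in> null_sets M" "Z \<subseteq> Z'" for B Z'
    proof -
      have "Z' \<in> null_sets A" using S(3) Z' unfolding absolutely_continuous_def by blast
      then have "emeasure A B = emeasure A (B - Z')"
        using B S(2) by (simp add: emeasure_Diff_null_set)
      moreover have "emeasure S (B - Z') \<le> emeasure S (space M - Z)"
        using B Z Z' S(1) sets.sets_into_space[OF B] by (intro emeasure_mono) auto
      ultimately show ?thesis
        using S(4)[of "B - Z'"] B Z' Z(3) by auto
    qed
    then show ?thesis using Z by (intro bexI[of _ Z]) auto
  qed
  from *[OF assms(1)] obtain Z1 where Z1: "Z1 \<in> null_sets M"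
    "\<And>B Z'. B \<in> sets M \<Longrightarrow> Z' \<in> null_sets M \<Longrightarrow> Z1 \<subseteq> Z' \<Longrightarrow> emeasure A1 B = emeasure N (B - Z')"
    by blast
  from *[OF assms(2)] obtain Z2 where Z2: "Z2 \<in> null_sets M"
    "\<And>B Z'. B \<in> sets M \<Longrightarrow> Z' \<in> null_sets M \<Longrightarrow> Z2 \<subseteq> Z' \<Longrightarrow> emeasure A2 B = emeasure N (B - Z')"
    by blast
  have sets: "sets A1 = sets M" "sets A2 = sets M"
    using assms by (auto simp: ac_component_def)
  show ?thesis
  proof (rule measure_eqI)
    fix B assume "B \<in> sets A1"
    then have "B \<in> sets M" using sets by simp
    then show "emeasure A1 B = emeasure A2 B"
      using Z1(1) Z2(1) Z1(2)[of B "Z1 \<union> Z2"] Z2(2)[of B "Z1 \<union> Z2"] by (simp add: null_sets.Un)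
  qed (use sets in simp)
qed

end

theory Submission
  imports Defs
begin

text \<open>
  Write \<open>b q\<close> for the normalised Bessel series with parameter \<open>q\<close>. The uniform distribution on
  the unit sphere has Laplace transform \<open>b (d / 2) (norm w)\<close>. With \<open>n\<close> changes of direction the Laplace
  transform of the position is therefore, up to normalisation, the \<open>(n + 1)\<close>-fold convolution at time
  \<open>t\<close> of the kernel \<open>s powr (a - 1) / Gamma a * b (d / 2) (c * norm w * s)\<close>. For \<open>a = d - 1\<close> and for
  \<open>a = d / 2 - 1\<close> this kernel belongs to a convolution semigroup of kernels
  \<open>s powr (A - 1) / Gamma A * b (q A) (c * norm w * s)\<close>, with \<open>q A = (A + 1) / 2\<close> by Vandermonde's identity,
  respectively \<open>q A = A + 1\<close> by the Rothe-Hagen identity. Hence the Laplace transform is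
  \<open>b (q ((n + 1) * a)) (c * t * norm w)\<close>, which for \<open>n \<ge> 1\<close> is also the transform of the density proportional to
  \<open>(c\<^sup>2 * t\<^sup>2 - (norm x)\<^sup>2) powr (p - 1)\<close> on the ball, where \<open>p = q ((n + 1) * a) - d / 2\<close>; laws with bounded support
  are determined by their Laplace transform. For \<open>n = 0\<close> the law is carried by a
  sphere and is singular. Summing the densities over \<open>n \<ge> 1\<close> with the weights of the fractional
  Poisson law gives the Mittag-Leffler series.
\<close>

subsection \<open>Convolution identities for rising factorials\<close>

text \<open>\<open>rothe k x = x / (x + 2 k) * ((x + 2 k) gchoose k)\<close> is the coefficient of \<open>z ^ k\<close> in the \<open>x\<close>-th
  power of the Catalan generating function.\<close>

definition rothe :: "nat \<Rightarrow> real \<Rightarrow> real" where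
  "rothe k x = (case k of 0 \<Rightarrow> 1 | Suc m \<Rightarrow> x * pochhammer (x + real m + 2) m / fact (Suc m))"

lemma rothe_0 [simp]: "rothe 0 x = 1"
  by (simp add: rothe_def)

lemma rothe_Suc: "rothe (Suc m) x = x * pochhammer (x + real m + 2) m / fact (Suc m)"
  by (simp add: rothe_def)

text \<open>The tail of \<open>pochhammer x (2 * k)\<close> after its first factor splits so that
  \<open>pochhammer (x + 1) k\<close> cancels. The quotient is the weight that the second model
  produces.\<close>

lemma rothe_pochhammer:
  assumes "x > 0"
  shows "rothe k x = pochhammer x (2 * k) / (fact k * pochhammer (x + 1) k)"
proof (cases k)
  case (Suc m)
  have "pochhammer x (2 * k) = x * pochhammer (x + 1) ((m + 1) + m)"
    by (simp add: Suc pochhammer_rec[of x] mult_2)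
  also have "\<dots> = x * (pochhammer (x + 1) k * pochhammer (x + real m + 2) m)"
    by (subst pochhammer_product') (simp add: Suc algebra_simps)
  finally show ?thesis
    using pochhammer_pos[of "x + 1" k] assms by (simp add: Suc rothe_Suc)
qed simp

text \<open>If \<open>C = 1 + z * C ^ 2\<close> is the Catalan generating function, its powers
  satisfy \<open>C ^ x - C ^ (x - 1) = z * C ^ (x + 1)\<close>; this is the equation between
  coefficients. The proof is direct: both terms on the left share the factor
  \<open>P\<close>.\<close>

lemma rothe_diff: "rothe (Suc m) x - rothe (Suc m) (x - 1) = rothe m (x + 1)"
proof (cases m)
  case (Suc j)
  define P where "P = pochhammer (x + real j + 3) j"
  have "pochhammer (x + real m + 2) m = P * (x + 2 * real j + 3)"
    by (simp add: Suc pochhammer_Suc P_def add_ac)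
  moreover have "pochhammer (x - 1 + real m + 2) m = (x + real j + 2) * P"
    by (simp add: Suc pochhammer_rec P_def add_ac)
  ultimately have "rothe (Suc m) x - rothe (Suc m) (x - 1) =
      (x * (P * (x + 2 * real j + 3)) - (x - 1) * ((x + real j + 2) * P)) / fact (Suc m)"
    by (simp only: rothe_Suc diff_divide_distrib)
  also have "\<dots> = (real j + 2) * ((x + 1) * P) / ((real j + 2) * fact m)"
    by (simp add: Suc algebra_simps)
  also have "\<dots> = (x + 1) * P / fact m"
    by (subst mult_divide_mult_cancel_left) auto
  also have "\<dots> = rothe m (x + 1)"
    by (simp add: rothe_Suc Suc P_def algebra_simps)
  finally show ?thesis .
qed (simp add: rothe_Suc)

lemma pochhammer_eq_poly: "\<exists>p. \<forall>x::real. pochhammer (x + c) m = poly p x"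
proof (induction m)
  case 0
  show ?case by (rule exI[of _ 1]) simp
next
  case (Suc m)
  then obtain p where "\<forall>x. pochhammer (x + c) m = poly p x" by blast
  then show ?case
    by (intro exI[of _ "p * [: c + real m, 1 :]"]) (simp add: pochhammer_Suc algebra_simps)
qed

text \<open>The defining form has a constant denominator, so it is polynomial on the whole line, and
  an identity between such functions can be checked at infinitely many points.\<close>

lemma rothe_eq_poly: "\<exists>p. \<forall>x. rothe k x = poly p x"
proof (cases k)
  case 0
  show ?thesis by (rule exI[of _ 1]) (simp add: 0)
next
  case (Suc m)
  obtain p where "\<And>x. pochhammer (x + (real m + 2)) m = poly p x"
    using pochhammer_eq_poly by blast
  then show ?thesis
    by (intro exI[of _ "smult (1 / fact k) ([: 0, 1 :] * p)"]) (simp add: Suc rothe_Suc add.assoc)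
qed

text \<open>The Rothe-Hagen identity. Both sides are polynomials in \<open>x\<close>; by induction their difference
  has period 1, so it is constant, and it vanishes at \<open>x = 0\<close>.\<close>

lemma rothe_hagen: "(\<Sum>i\<le>k. rothe i x * rothe (k - i) y) = rothe k (x + y)"
proof (induction k arbitrary: x y)
  case (Suc k)
  define T where "T x = (\<Sum>i\<le>Suc k. rothe i x * rothe (Suc k - i) y) - rothe (Suc k) (x + y)" for x
  \<comment> \<open>The split-off term \<open>i = 0\<close> does not depend on \<open>x\<close>, so
    it drops out of \<open>T x - T (x - 1)\<close>.\<close>
  have T: "T x = rothe (Suc k) y + (\<Sum>i\<le>k. rothe (Suc i) x * rothe (k - i) y)
      - rothe (Suc k) (x + y)" for x
    by (simp only: T_def sum.atMost_Suc_shift) simp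
  have periodic: "T x = T (x - 1)" for x
  proof -
    have "T x - T (x - 1) = (\<Sum>i\<le>k. (rothe (Suc i) x - rothe (Suc i) (x - 1)) * rothe (k - i) y)
        - (rothe (Suc k) (x + y) - rothe (Suc k) (x + y - 1))"
      by (simp add: T left_diff_distrib sum_subtractf algebra_simps)
    \<comment> \<open>\<open>rothe_diff\<close> lowers the degree by one and moves \<open>x\<close>
      to \<open>x + 1\<close>, where the induction hypothesis applies.\<close>
    also have "\<dots> = 0"
      by (simp only: rothe_diff Suc.IH) (simp add: algebra_simps)
    finally show ?thesis by simp
  qed
  have "T 0 = 0"
    by (simp add: T rothe_Suc)
  then have nat: "T (real n) = 0" for n
    by (induction n) (use periodic[of "1 + real _"] in auto)
  obtain p where p: "\<And>i x. rothe i x = poly (p i) x"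
    using rothe_eq_poly by metis
  obtain q where q: "\<And>x. T x = poly q x"
  proof
    fix x
    show "T x = poly ((\<Sum>i\<le>Suc k. smult (rothe (Suc k - i) y) (p i)) - pcompose (p (Suc k)) [:y, 1:]) x"
      by (simp add: T_def poly_sum poly_pcompose p[symmetric] algebra_simps del: sum.atMost_Suc)
  qed
  have "range real \<subseteq> {x. poly q x = 0}"
    using nat q by auto
  moreover have "infinite (range real)"
    using finite_imageD[of real UNIV] inj_of_nat by auto
  ultimately have "q = 0"
    using poly_roots_finite finite_subset by blast
  then show ?case
    using q[of x] by (simp add: T_def)
qed simp

lemma vandermonde_pochhammer:
  fixes x y :: real
  shows "(\<Sum>i\<le>k. pochhammer x i / fact i * (pochhammer y (k - i) / fact (k - i))) =
    pochhammer (x + y) k / fact k"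
proof -
  have "pochhammer (x + y) k / fact k =
      (\<Sum>i\<le>k. real (k choose i) * pochhammer x i * pochhammer y (k - i) / fact k)"
    by (simp add: pochhammer_binomial_sum sum_divide_distrib)
  also have "\<dots> = (\<Sum>i\<le>k. pochhammer x i / fact i * (pochhammer y (k - i) / fact (k - i)))"
    by (intro sum.cong refl) (simp add: binomial_fact)
  finally show ?thesis by simp
qed

subsection \<open>Polar coordinates\<close>

text \<open>The law of \<open>(norm x)\<^sup>2\<close> under Lebesgue measure on a \<open>d\<close>-dimensional space. Using the square
  of the radius makes all radial integrals below Gamma and Beta integrals without substitution.\<close>

definition sq_norm_measure :: "real \<Rightarrow> real measure" where
  "sq_norm_measure d = density lborel
    (\<lambda>u. ennreal (indicator {0<..} u * (pi powr (d / 2) / Gamma (d / 2) * u powr (d / 2 - 1))))"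

lemma sets_sq_norm_measure [simp, measurable_cong]: "sets (sq_norm_measure d) = sets borel"
  by (simp add: sq_norm_measure_def)

lemma space_sq_norm_measure [simp]: "space (sq_norm_measure d) = UNIV"
  by (simp add: sq_norm_measure_def)

text \<open>The right-hand side is the volume of the ball of radius \<open>sqrt r\<close>; this is
  what identifies the measure with the law of the squared norm.\<close>

lemma emeasure_sq_norm_measure_lessThan:
  assumes d: "d > 0" and r: "r \<ge> 0"
  shows "emeasure (sq_norm_measure d) {..<r} = ennreal (unit_ball_vol d * r powr (d / 2))"
proof -
  define C where "C = pi powr (d / 2) / Gamma (d / 2)"
  have C: "C \<ge> 0" using d by (simp add: C_def)
  have "((\<lambda>u. C * u powr (d / 2 - 1)) has_integral C * (r powr (d / 2) / (d / 2))) {0..r}"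
    using has_integral_powr_from_0[of "d / 2 - 1" r] d r by (intro has_integral_mult_right) auto
  then have "((\<lambda>u. indicator {0..r} u * (C * u powr (d / 2 - 1))) has_integral C * (r powr (d / 2) / (d / 2))) UNIV"
    by (subst (asm) has_integral_restrict_UNIV[symmetric], elim has_integral_eq[rotated]) auto
  then have "(\<integral>\<^sup>+u. ennreal (indicator {0..r} u * (C * u powr (d / 2 - 1))) \<partial>lborel) =
      ennreal (C * (r powr (d / 2) / (d / 2)))"
    using C by (intro nn_integral_has_integral_lborel) (auto simp: indicator_def)
  moreover have "emeasure (sq_norm_measure d) {..<r} =
      (\<integral>\<^sup>+u. ennreal (indicator {0..r} u * (C * u powr (d / 2 - 1))) \<partial>lborel)"
  proof -
    have "AE u in lborel. u \<noteq> 0 \<and> u \<noteq> r"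
      using AE_lborel_singleton[of 0] AE_lborel_singleton[of r] by eventually_elim simp
    then have "AE u in lborel. ennreal (indicator {0<..} u * (C * u powr (d / 2 - 1))) * indicator {..<r} u =
        ennreal (indicator {0..r} u * (C * u powr (d / 2 - 1)))"
      by eventually_elim (auto simp: indicator_def)
    then show ?thesis
      unfolding sq_norm_measure_def C_def[symmetric]
      by (subst emeasure_density) (auto intro!: nn_integral_cong_AE)
  qed
  moreover have "C * (r powr (d / 2) / (d / 2)) = unit_ball_vol d * r powr (d / 2)"
  proof -
    have "x \<notin> \<int>\<^sub>\<le>\<^sub>0" if "x > 0" for x :: real
      using that by (auto elim!: nonpos_Ints_cases)
    then have "Gamma (d / 2 + 1) = d / 2 * Gamma (d / 2)"
      using d by (intro Gamma_plus1) auto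
    then show ?thesis by (simp only: C_def unit_ball_vol_def) (simp add: ac_simps)
  qed
  ultimately show ?thesis by simp
qed

lemma AE_sq_norm_measure: "AE u in sq_norm_measure d. u > 0"
  unfolding sq_norm_measure_def by (subst AE_density) (auto simp: indicator_def)

lemma emeasure_sq_norm_measure_nonpos:
  "r \<le> 0 \<Longrightarrow> emeasure (sq_norm_measure d) {..<r} = 0"
  unfolding sq_norm_measure_def by (subst emeasure_density) (auto simp: nn_integral_0_iff_AE indicator_def)

text \<open>\<open>sgn\<close> is invariant under positive scaling, so scaling by \<open>s\<close>
  carries the cone over \<open>B\<close> in the unit ball to the one in the ball of radius
  \<open>s\<close>.\<close>

lemma emeasure_ball_cone:
  fixes B :: "(real ^ 'd) set"
  assumes B: "B \<in> sets borel" and s: "s > 0"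
  shows "emeasure lborel (ball 0 s \<inter> sgn -` B) =
    ennreal (unit_ball_vol CARD('d) * s ^ CARD('d)) * emeasure uniform_sphere B"
proof -
  let ?V = "emeasure lborel (ball 0 1 :: (real ^ 'd) set)"
  have sB: "sgn -` B \<in> sets borel" using measurable_sets[OF measurable_sgn_vec B] by simp
  have V: "?V = ennreal (unit_ball_vol CARD('d))"
    by (subst emeasure_ball) auto
  have "emeasure lborel (ball 0 s \<inter> sgn -` B) =
      emeasure (density (distr lborel borel (\<lambda>x::real^'d. 0 + s *\<^sub>R x)) (\<lambda>_. \<bar>s\<bar>^DIM(real^'d))) (ball 0 s \<inter> sgn -` B)"
    using lborel_affine[of s "0 :: real^'d"] s by simp
  also have "\<dots> = ennreal (s ^ CARD('d)) * emeasure lborel ((\<lambda>x::real^'d. s *\<^sub>R x) -` (ball 0 s \<inter> sgn -` B))"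
    using s sB by (simp add: emeasure_density_const emeasure_distr)
  also have "(\<lambda>x::real^'d. s *\<^sub>R x) -` (ball 0 s \<inter> sgn -` B) = ball 0 1 \<inter> sgn -` B"
    using s by (auto simp: sgn_scaleR)
  also have "emeasure lborel \<dots> = ?V * emeasure uniform_sphere B"
  proof -
    let ?X = "emeasure lborel (ball 0 1 \<inter> sgn -` B)"
    have "?X * ?V / ?V = ?X"
      using emeasure_unit_ball[where 'd = 'd] by (intro ennreal_mult_divide_eq) auto
    then show ?thesis
      unfolding emeasure_uniform_sphere[OF B] ennreal_times_divide by (simp only: mult.commute)
  qed
  finally show ?thesis
    using s by (simp add: V ennreal_mult ac_simps)
qed

text \<open>Squared norm and direction are independent under Lebesgue measure. For a fixed set
  \<open>B\<close> of directions both sides are measures in the radial variable; they agree on the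
  half-lines \<open>{..<r}\<close>, which form an intersection-stable generator.\<close>

lemma distr_sq_norm_sgn:
  "distr lborel (borel \<Otimes>\<^sub>M borel) (\<lambda>x :: real ^ 'd. ((norm x)\<^sup>2, sgn x)) =
    sq_norm_measure CARD('d) \<Otimes>\<^sub>M uniform_sphere"
proof (rule pair_measure_eqI[symmetric])
  interpret S: prob_space "uniform_sphere :: (real ^ 'd) measure" by (rule prob_space_uniform_sphere)
  let ?P = "sq_norm_measure CARD('d)"
  show "sigma_finite_measure (uniform_sphere :: (real ^ 'd) measure)" ..
  show "sigma_finite_measure ?P"
  proof
    show "\<exists>A. countable A \<and> A \<subseteq> sets ?P \<and> \<Union> A = space ?P \<and> (\<forall>a\<in>A. emeasure ?P a \<noteq> \<infinity>)"
      by (intro exI[of _ "range (\<lambda>n. {..<real n})"])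
        (auto simp: emeasure_sq_norm_measure_lessThan reals_Archimedean2)
  qed
  show "sets (?P \<Otimes>\<^sub>M uniform_sphere) =
      sets (distr lborel (borel \<Otimes>\<^sub>M borel) (\<lambda>x :: real ^ 'd. ((norm x)\<^sup>2, sgn x)))"
    by (simp cong: sets_pair_measure_cong)
  fix A :: "real set" and B :: "(real ^ 'd) set"
  assume "A \<in> sets ?P" "B \<in> sets uniform_sphere"
  then have [measurable]: "A \<in> sets borel" "B \<in> sets borel" by auto
  have sB [measurable]: "sgn -` B \<in> sets borel"
    using measurable_sets[OF measurable_sgn_vec, of B] by simp
  \<comment> \<open>The law of the squared norm restricted to the cone over
    \<open>B\<close>.\<close>
  let ?N = "distr (density lborel (indicator (sgn -` B))) borel (\<lambda>x :: real ^ 'd. (norm x)\<^sup>2)"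
  have N: "emeasure ?N C = emeasure lborel ({x :: real ^ 'd. (norm x)\<^sup>2 \<in> C} \<inter> sgn -` B)"
    if [measurable]: "C \<in> sets borel" for C
  proof -
    have [measurable]: "(\<lambda>x :: real ^ 'd. (norm x)\<^sup>2) -` C \<in> sets borel"
      by (rule measurable_sets_borel[OF _ that]) measurable
    have "emeasure ?N C = (\<integral>\<^sup>+x. indicator ((\<lambda>x. (norm x)\<^sup>2) -` C \<inter> sgn -` B) x \<partial>lborel)"
      by (subst emeasure_distr, simp, simp, subst emeasure_density)
        (auto simp: indicator_def simp del: nn_integral_indicator intro!: nn_integral_cong)
    also have "\<dots> = emeasure lborel ((\<lambda>x. (norm x)\<^sup>2) -` C \<inter> sgn -` B)"
      by (subst nn_integral_indicator) auto
    finally show ?thesis by (simp add: vimage_def)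
  qed
  have eq: "emeasure ?N {..<r} = emeasure (scale_measure (emeasure uniform_sphere B) ?P) {..<r}" for r
  proof (cases "r > 0")
    case True
    have "{x :: real ^ 'd. (norm x)\<^sup>2 \<in> {..<r}} = ball 0 (sqrt r)"
      by (auto simp: real_less_rsqrt real_sqrt_less_iff dest: real_sqrt_less_mono)
        (metis True abs_of_pos norm_ge_zero power_strict_mono real_sqrt_pow2_iff zero_less_numeral less_imp_le)
    moreover have "sqrt r ^ CARD('d) = r powr (real CARD('d) / 2)"
      using True by (simp add: powr_half_sqrt[symmetric] powr_powr powr_realpow[symmetric])
    ultimately show ?thesis
      using True emeasure_ball_cone[of B "sqrt r"]
      by (simp add: N emeasure_sq_norm_measure_lessThan mult.commute)
  next
    case False
    then have "{x :: real ^ 'd. (norm x)\<^sup>2 \<in> {..<r}} = {}"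
      by (auto simp: not_less) (meson order.trans zero_le_power2)
    then show ?thesis
      using False by (simp add: N emeasure_sq_norm_measure_nonpos)
  qed
  have "?N = scale_measure (emeasure uniform_sphere B) ?P"
  proof (rule measure_eqI_generator_eq[where E = "range (\<lambda>r. {..<r})" and \<Omega> = UNIV and A = "\<lambda>n. {..<real n}"])
    show "Int_stable (range (\<lambda>r::real. {..<r}))"
    proof (rule Int_stableI; clarify)
      fix a b :: real
      have "{..<a} \<inter> {..<b} = {..<min a b}" by auto
      then show "{..<a} \<inter> {..<b} \<in> range lessThan" by simp
    qed
    have "sets borel = sigma_sets UNIV (range (\<lambda>r::real. {..<r}))"
      by (subst borel_eq_lessThan) (simp add: eucl_lessThan lessThan_def)
    then show "sets ?N = sigma_sets UNIV (range (\<lambda>r. {..<r}))"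
      "sets (scale_measure (emeasure uniform_sphere B) ?P) = sigma_sets UNIV (range (\<lambda>r. {..<r}))"
      by simp_all
    show "(\<Union>n. {..<real n}) = UNIV"
      by (auto simp: reals_Archimedean2)
    show "emeasure ?N {..<real n} \<noteq> \<infinity>" for n
      using S.emeasure_finite[of B]
      by (simp add: eq emeasure_sq_norm_measure_lessThan ennreal_mult_eq_top_iff)
  qed (use eq in auto)
  then have "emeasure ?P A * emeasure uniform_sphere B = emeasure ?N A"
    by (simp only: emeasure_scale_measure mult.commute)
  also have "\<dots> = emeasure lborel ({x :: real ^ 'd. (norm x)\<^sup>2 \<in> A} \<inter> sgn -` B)"
    by (rule N) simp
  also have "{x :: real ^ 'd. (norm x)\<^sup>2 \<in> A} \<inter> sgn -` B = (\<lambda>x. ((norm x)\<^sup>2, sgn x)) -` (A \<times> B)"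
    by auto
  also have "emeasure lborel \<dots> =
      emeasure (distr lborel (borel \<Otimes>\<^sub>M borel) (\<lambda>x :: real ^ 'd. ((norm x)\<^sup>2, sgn x))) (A \<times> B)"
    by (subst emeasure_distr) auto
  finally show "emeasure ?P A * emeasure uniform_sphere B =
      emeasure (distr lborel (borel \<Otimes>\<^sub>M borel) (\<lambda>x :: real ^ 'd. ((norm x)\<^sup>2, sgn x))) (A \<times> B)" .
qed

lemma nn_integral_polar:
  fixes F :: "real ^ 'd \<Rightarrow> ennreal"
  assumes [measurable]: "F \<in> borel_measurable borel"
  shows "(\<integral>\<^sup>+x. F x \<partial>lborel) =
    (\<integral>\<^sup>+u. (\<integral>\<^sup>+v. F (sqrt u *\<^sub>R v) \<partial>uniform_sphere) \<partial>sq_norm_measure CARD('d))"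
proof -
  interpret S: prob_space "uniform_sphere :: (real ^ 'd) measure" by (rule prob_space_uniform_sphere)
  let ?G = "\<lambda>(u, v :: real ^ 'd). F (sqrt u *\<^sub>R v)"
  have G: "?G \<in> borel_measurable (borel \<Otimes>\<^sub>M borel)"
    by measurable
  have "(\<integral>\<^sup>+x. F x \<partial>lborel) = (\<integral>\<^sup>+x. ?G ((norm x)\<^sup>2, sgn x) \<partial>lborel)"
  proof (intro nn_integral_cong)
    show "F x = ?G ((norm x)\<^sup>2, sgn x)" for x
      by (cases "x = 0") (simp_all add: sgn_div_norm)
  qed
  also have "\<dots> = (\<integral>\<^sup>+p. ?G p \<partial>distr lborel (borel \<Otimes>\<^sub>M borel) (\<lambda>x :: real ^ 'd. ((norm x)\<^sup>2, sgn x)))"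
    using G by (subst nn_integral_distr) auto
  also have "\<dots> = (\<integral>\<^sup>+p. ?G p \<partial>(sq_norm_measure CARD('d) \<Otimes>\<^sub>M uniform_sphere))"
    by (simp add: distr_sq_norm_sgn)
  also have "\<dots> = (\<integral>\<^sup>+u. (\<integral>\<^sup>+v. F (sqrt u *\<^sub>R v) \<partial>uniform_sphere) \<partial>sq_norm_measure CARD('d))"
    by (subst S.nn_integral_fst[symmetric]) auto
  finally show ?thesis .
qed

subsection \<open>The Laplace transform of the uniform distribution on the sphere\<close>

text \<open>Only \<open>y \<ge> 0\<close> is assumed because \<open>y\<close> will be the square of
  a real number. Once the coefficients below \<open>n\<close> of the difference are known to vanish,
  division by \<open>y ^ n\<close> and the limit from the right at 0 isolate the next one.\<close>

lemma powser_sums_unique: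
  fixes a b :: "nat \<Rightarrow> real"
  assumes a: "\<And>y. y \<ge> 0 \<Longrightarrow> (\<lambda>n. a n * y ^ n) sums f y"
    and b: "\<And>y. y \<ge> 0 \<Longrightarrow> (\<lambda>n. b n * y ^ n) sums f y"
  shows "a n = b n"
proof -
  define d where "d n = a n - b n" for n
  have d: "(\<lambda>n. d n * y ^ n) sums 0" if "y \<ge> 0" for y
    using sums_diff[OF a[OF that] b[OF that]] by (simp add: d_def algebra_simps)
  have "d n = 0"
  proof (induction n rule: less_induct)
    case (less n)
    define g where "g y = (\<Sum>k. d (k + n) * y ^ k)" for y
    have shifted: "(\<lambda>k. d (k + n) * y ^ k) sums 0" if "y > 0" for y
    proof -
      have "(\<lambda>k. d (k + n) * y ^ (k + n)) sums 0"
        using sums_iff_shift[of "\<lambda>k. d k * y ^ k" n 0] d[of y] less that by simp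
      from sums_divide[OF this, of "y ^ n"] that show ?thesis
        by (simp add: power_add)
    qed
    have "(\<lambda>k. d (k + n) * y ^ k) sums g y" if "norm y < 1" for y
      using powser_inside[of "\<lambda>k. d (k + n)" 1 y] shifted[of 1] that
      by (auto simp: g_def sums_iff)
    then have "(g \<longlongrightarrow> d n) (at 0)"
      using powser_limit_0[of 1 "\<lambda>k. d (k + n)" g] by simp
    then have "(g \<longlongrightarrow> d n) (at_right 0)"
      by (rule filterlim_mono) (auto simp: at_le)
    moreover have "eventually (\<lambda>y. 0 = g y) (at_right 0)"
      using shifted by (auto simp: g_def sums_iff intro!: eventually_at_rightI[of 0 1])
    then have "(g \<longlongrightarrow> 0) (at_right 0)"
      by (rule Lim_transform_eventually[OF tendsto_const])
    ultimately show "d n = 0"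
      using tendsto_unique[of "at_right (0::real)" g] by simp
  qed
  then show ?thesis by (simp add: d_def)
qed

text \<open>The normalised modified Bessel function \<open>Gamma q * (2 / s) powr (q - 1) * I (q - 1) s\<close>.\<close>

definition bessel :: "real \<Rightarrow> real \<Rightarrow> ennreal" where
  "bessel q s = (\<Sum>k. ennreal ((s\<^sup>2 / 4) ^ k / (fact k * pochhammer q k)))"

lemma bessel_0 [simp]: "bessel q 0 = 1"
  unfolding bessel_def by (subst suminf_finite[of "{0}"]) (auto simp: power_0_left)

lemma cosh_sums_even: "(\<lambda>k. x ^ (2 * k) / fact (2 * k)) sums cosh (x :: real)"
proof -
  have "(\<lambda>k. (\<lambda>n. if even n then x ^ n /\<^sub>R fact n else 0) (2 * k)) sums cosh x"
    by (subst sums_mono_reindex[of "\<lambda>k. 2 * k"])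
      (auto simp: strict_mono_def elim!: evenE intro: cosh_converges)
  then show ?thesis by (simp add: divide_inverse mult.commute)
qed

lemma distr_uniform_sphere_uminus: "distr uniform_sphere borel uminus = (uniform_sphere :: (real ^ 'd) measure)"
  by (rule uniform_sphere_rotation_invariant) (auto simp: orthogonal_transformation_def intro!: linearI)

text \<open>Reflection invariance allows \<open>exp\<close> to be replaced by \<open>cosh\<close>.
  Its power series has nonnegative terms, so it may be integrated term by term in
  \<open>ennreal\<close>.\<close>

lemma nn_integral_uniform_sphere_exp_moments:
  fixes u :: "real ^ 'd"
  shows "(\<integral>\<^sup>+v. ennreal (exp (s * (u \<bullet> v))) \<partial>uniform_sphere) =
    (\<Sum>k. ennreal (s ^ (2 * k) / fact (2 * k)) * (\<integral>\<^sup>+v. ennreal ((u \<bullet> v) ^ (2 * k)) \<partial>uniform_sphere))"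
proof -
  let ?I = "\<lambda>s. \<integral>\<^sup>+v. ennreal (exp (s * (u \<bullet> v))) \<partial>uniform_sphere"
  have "?I s = (\<integral>\<^sup>+v. ennreal (exp (s * (u \<bullet> v))) \<partial>distr uniform_sphere borel uminus)"
    by (simp add: distr_uniform_sphere_uminus)
  also have "\<dots> = ?I (- s)"
    by (subst nn_integral_distr) auto
  finally have "2 * ?I s = ?I s + ?I (- s)"
    by (simp add: mult_2)
  also have "\<dots> = (\<integral>\<^sup>+v. 2 * ennreal (cosh (s * (u \<bullet> v))) \<partial>uniform_sphere)"
    by (subst nn_integral_add[symmetric])
      (auto intro!: nn_integral_cong simp: ennreal_plus[symmetric] ennreal_mult'[symmetric] cosh_field_def simp del: ennreal_plus
        simp flip: ennreal_numeral)
  also have "\<dots> = 2 * (\<integral>\<^sup>+v. ennreal (cosh (s * (u \<bullet> v))) \<partial>uniform_sphere)"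
    by (subst nn_integral_cmult) (auto simp: cosh_field_def)
  finally have "?I s = (\<integral>\<^sup>+v. ennreal (cosh (s * (u \<bullet> v))) \<partial>uniform_sphere)"
    by (simp add: ennreal_mult_cancel_left)
  also have "\<dots> = (\<integral>\<^sup>+v. (\<Sum>k. ennreal (s ^ (2 * k) / fact (2 * k)) * ennreal ((u \<bullet> v) ^ (2 * k))) \<partial>uniform_sphere)"
  proof (intro nn_integral_cong)
    fix v
    have "(\<Sum>k. ennreal ((s * (u \<bullet> v)) ^ (2 * k) / fact (2 * k))) = ennreal (cosh (s * (u \<bullet> v)))"
      using cosh_sums_even[of "s * (u \<bullet> v)"] by (intro suminf_ennreal_eq) (auto simp: zero_le_even_power)
    then show "ennreal (cosh (s * (u \<bullet> v))) =
        (\<Sum>k. ennreal (s ^ (2 * k) / fact (2 * k)) * ennreal ((u \<bullet> v) ^ (2 * k)))"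
      by (simp add: ennreal_mult'[symmetric] power_mult_distrib zero_le_even_power)
  qed
  also have "\<dots> = (\<Sum>k. ennreal (s ^ (2 * k) / fact (2 * k)) * (\<integral>\<^sup>+v. ennreal ((u \<bullet> v) ^ (2 * k)) \<partial>uniform_sphere))"
    by (subst nn_integral_suminf) (auto simp: nn_integral_cmult)
  finally show ?thesis .
qed

section \<open>Gaussian integrals and the moments of the uniform distribution on the sphere\<close>

lemma nn_integral_sq_norm_measure:
  assumes [measurable]: "f \<in> borel_measurable borel" and d: "d > 0"
  shows "(\<integral>\<^sup>+u. f u \<partial>sq_norm_measure d) = ennreal (pi powr (d / 2) / Gamma (d / 2)) *
    (\<integral>\<^sup>+u. ennreal (indicator {0<..} u * u powr (d / 2 - 1)) * f u \<partial>lborel)"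
  using d unfolding sq_norm_measure_def
  by (subst nn_integral_density, simp, simp, subst nn_integral_cmult[symmetric], simp)
    (auto intro!: nn_integral_cong simp: indicator_def ennreal_mult''[symmetric] mult.assoc[symmetric])

lemma nn_integral_sq_norm_measure_exp:
  assumes d: "d > 0"
  shows "(\<integral>\<^sup>+u. ennreal (u ^ k * exp (- u)) \<partial>sq_norm_measure d) =
    ennreal (pi powr (d / 2) * pochhammer (d / 2) k)"
proof -
  have "(\<integral>\<^sup>+u. ennreal (indicator {0<..} u * u powr (d / 2 - 1)) * ennreal (u ^ k * exp (- u)) \<partial>lborel) =
      (\<integral>\<^sup>+u. ennreal (indicator {0..} u * u powr (d / 2 + real k - 1) / exp u) \<partial>lborel)"
  proof (intro nn_integral_cong_AE)
    show "AE u in lborel. ennreal (indicator {0<..} u * u powr (d / 2 - 1)) * ennreal (u ^ k * exp (- u)) =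
        ennreal (indicator {0..} u * u powr (d / 2 + real k - 1) / exp u)"
      using AE_lborel_singleton[of 0]
    proof eventually_elim
      case (elim u)
      have "u powr (d / 2 + real k - 1) = u powr (d / 2 - 1) * u ^ k" if "u > 0"
        using that powr_add[of u "d / 2 - 1" "real k"] by (simp add: powr_realpow add_diff_eq add.commute)
      then have "u powr (d / 2 - 1) * (u ^ k * exp (- u)) = u powr (d / 2 + real k - 1) / exp u" if "u > 0"
        using that by (simp add: exp_minus_inverse exp_minus field_simps)
      then show ?case
        using elim by (simp add: indicator_def ennreal_mult'[symmetric])
    qed
  qed
  also have "\<dots> = ennreal (Gamma (d / 2 + real k))"
    using d by (intro Gamma_conv_nn_integral_real[symmetric]) auto
  finally have "(\<integral>\<^sup>+u. ennreal (u ^ k * exp (- u)) \<partial>sq_norm_measure d) =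
      ennreal (pi powr (d / 2) / Gamma (d / 2)) * ennreal (Gamma (d / 2 + real k))"
    using d by (subst nn_integral_sq_norm_measure) auto
  moreover have "x \<notin> \<int>\<^sub>\<le>\<^sub>0" if "x > 0" for x :: real
    using that by (auto elim!: nonpos_Ints_cases)
  then have "pochhammer (d / 2) k = Gamma (d / 2 + real k) / Gamma (d / 2)"
    using d by (intro pochhammer_Gamma) auto
  ultimately show ?thesis
    using d by (simp add: ennreal_mult'[symmetric])
qed

text \<open>Completing the square. Expanding the left-hand side in polar coordinates instead identifies
  the moments of the uniform distribution on the sphere.\<close>

lemma nn_integral_gaussian_exp:
  fixes u :: "real ^ 'd"
  assumes u: "norm u = 1"
  shows "(\<integral>\<^sup>+x. ennreal (exp (- (norm x)\<^sup>2) * exp (s * (u \<bullet> x))) \<partial>lborel) =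
    ennreal (pi powr (CARD('d) / 2) * exp (s\<^sup>2 / 4))"
proof -
  let ?G = "\<lambda>x :: real ^ 'd. exp (- (norm x)\<^sup>2)"
  have "(\<integral>\<^sup>+x. ennreal (?G x) \<partial>lborel) = (\<integral>\<^sup>+r. ennreal (exp (- r)) \<partial>sq_norm_measure CARD('d))"
  proof -
    interpret S: prob_space "uniform_sphere :: (real ^ 'd) measure" by (rule prob_space_uniform_sphere)
    have "(\<integral>\<^sup>+x. ennreal (?G x) \<partial>lborel) =
      (\<integral>\<^sup>+r. (\<integral>\<^sup>+v. ennreal (?G (sqrt r *\<^sub>R v)) \<partial>uniform_sphere) \<partial>sq_norm_measure CARD('d))"
      by (rule nn_integral_polar) measurable
    also have "\<dots> = (\<integral>\<^sup>+r. (\<integral>\<^sup>+v. ennreal (exp (- r)) \<partial>(uniform_sphere :: (real ^ 'd) measure)) \<partial>sq_norm_measure CARD('d))"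
    proof (intro nn_integral_cong_AE)
      have "AE v in (uniform_sphere :: (real ^ 'd) measure). ennreal (?G (sqrt r *\<^sub>R v)) = ennreal (exp (- r))"
        if "r > 0" for r
        using AE_uniform_sphere by eventually_elim (use that in \<open>simp add: power_mult_distrib\<close>)
      then have "(\<integral>\<^sup>+v. ennreal (?G (sqrt r *\<^sub>R v)) \<partial>uniform_sphere) =
          (\<integral>\<^sup>+v. ennreal (exp (- r)) \<partial>(uniform_sphere :: (real ^ 'd) measure))" if "r > 0" for r
        using that by (intro nn_integral_cong_AE)
      then show "AE r in sq_norm_measure CARD('d). (\<integral>\<^sup>+v. ennreal (?G (sqrt r *\<^sub>R v)) \<partial>uniform_sphere) =
          (\<integral>\<^sup>+v. ennreal (exp (- r)) \<partial>(uniform_sphere :: (real ^ 'd) measure))"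
        by (rule eventually_mono[OF AE_sq_norm_measure])
    qed
    also have "\<dots> = (\<integral>\<^sup>+r. ennreal (exp (- r)) \<partial>sq_norm_measure CARD('d))"
      using S.emeasure_space_1 by simp
    finally show ?thesis .
  qed
  also have "\<dots> = ennreal (pi powr (CARD('d) / 2))"
    using nn_integral_sq_norm_measure_exp[of "real CARD('d)" 0] by simp
  finally have I: "(\<integral>\<^sup>+x. ennreal (?G x) \<partial>lborel) = ennreal (pi powr (CARD('d) / 2))" .
  have sq: "exp (- (norm x)\<^sup>2) * exp (s * (u \<bullet> x)) = exp (s\<^sup>2 / 4) * ?G (- (s / 2) *\<^sub>R u + x)" for x
  proof -
    have "u \<bullet> u = 1" using u by (simp add: dot_square_norm)
    then have "(norm (- (s / 2) *\<^sub>R u + x))\<^sup>2 = (norm x)\<^sup>2 - s * (u \<bullet> x) + s\<^sup>2 / 4"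
      unfolding power2_norm_eq_inner
      by (simp add: inner_add inner_diff inner_commute power2_eq_square algebra_simps)
    then show ?thesis by (simp add: exp_add[symmetric])
  qed
  have "(\<integral>\<^sup>+x. ennreal (?G x) \<partial>lborel) = (\<integral>\<^sup>+x. ennreal (?G x) \<partial>distr lborel borel ((+) (- (s / 2) *\<^sub>R u)))"
    by (simp only: lborel_distr_plus)
  also have "\<dots> = (\<integral>\<^sup>+x. ennreal (?G (- (s / 2) *\<^sub>R u + x)) \<partial>lborel)"
    by (subst nn_integral_distr) auto
  finally show ?thesis
    unfolding sq using I by (simp add: ennreal_mult' nn_integral_cmult mult.commute)
qed

text \<open>The Gaussian integral has the closed form
  \<open>pi powr (d / 2) * exp (s\<^sup>2 / 4)\<close> and, in polar coordinates, a series in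
  \<open>s\<^sup>2\<close> with the even moments as unknowns. Comparing coefficients gives the
  moments, hence the exponential integral.\<close>

lemma nn_integral_uniform_sphere_exp_unit:
  fixes u :: "real ^ 'd"
  assumes u: "norm u = 1"
  shows "(\<integral>\<^sup>+v. ennreal (exp (s * (u \<bullet> v))) \<partial>uniform_sphere) = bessel (CARD('d) / 2) s"
proof -
  interpret S: prob_space "uniform_sphere :: (real ^ 'd) measure" by (rule prob_space_uniform_sphere)
  let ?d = "real CARD('d)"
  let ?M = "\<lambda>k. \<integral>\<^sup>+v. ennreal ((u \<bullet> v) ^ (2 * k)) \<partial>uniform_sphere"
  \<comment> \<open>By Cauchy-Schwarz the moments are at most 1, so they may be treated as real
    numbers when coefficients are compared.\<close>
  have "?M k < \<infinity>" for k
  proof -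
    have "?M k \<le> (\<integral>\<^sup>+v. 1 \<partial>(uniform_sphere :: (real ^ 'd) measure))"
    proof (intro nn_integral_mono_AE)
      show "AE v in uniform_sphere. ennreal ((u \<bullet> v) ^ (2 * k)) \<le> 1"
        using AE_uniform_sphere
      proof eventually_elim
        case (elim v)
        have "\<bar>u \<bullet> v\<bar> ^ (2 * k) \<le> 1"
          using Cauchy_Schwarz_ineq2[of u v] u elim by (intro power_le_one) auto
        then show ?case by (simp add: power_even_abs)
      qed
    qed
    then show ?thesis by (simp add: S.emeasure_space_1[simplified] order_le_less_trans)
  qed
  note M_finite = this
  define m where "m k = enn2real (?M k)" for k
  have m: "?M k = ennreal (m k)" "m k \<ge> 0" for k
    using M_finite[of k] by (simp_all add: m_def)
  define P where "P k = pochhammer (?d / 2) k" for k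
  have P: "P k > 0" for k by (simp add: P_def pochhammer_pos)
  have series: "ennreal (pi powr (?d / 2) * exp (s\<^sup>2 / 4)) =
      (\<Sum>k. ennreal (pi powr (?d / 2) * (s ^ (2 * k) / fact (2 * k) * m k * P k)))" for s
  proof -
    have "ennreal (pi powr (?d / 2) * exp (s\<^sup>2 / 4)) =
        (\<integral>\<^sup>+x. ennreal (exp (- (norm x)\<^sup>2) * exp (s * (u \<bullet> x))) \<partial>lborel)"
      by (rule nn_integral_gaussian_exp[OF u, symmetric])
    also have "\<dots> = (\<integral>\<^sup>+r. (\<integral>\<^sup>+v. ennreal (exp (- (norm (sqrt r *\<^sub>R v))\<^sup>2) * exp (s * (u \<bullet> (sqrt r *\<^sub>R v)))) \<partial>uniform_sphere)
        \<partial>sq_norm_measure CARD('d))"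
      by (rule nn_integral_polar) measurable
    also have "\<dots> = (\<integral>\<^sup>+r. (\<Sum>k. ennreal (s ^ (2 * k) / fact (2 * k) * m k) * ennreal (r ^ k * exp (- r))) \<partial>sq_norm_measure CARD('d))"
    proof (intro nn_integral_cong_AE eventually_mono[OF AE_sq_norm_measure])
      fix r :: real assume r: "r > 0"
      have "(\<integral>\<^sup>+v. ennreal (exp (- (norm (sqrt r *\<^sub>R v))\<^sup>2) * exp (s * (u \<bullet> (sqrt r *\<^sub>R v)))) \<partial>uniform_sphere) =
          (\<integral>\<^sup>+v. ennreal (exp (- r)) * ennreal (exp ((s * sqrt r) * (u \<bullet> v))) \<partial>uniform_sphere)"
        using r by (intro nn_integral_cong_AE eventually_mono[OF AE_uniform_sphere])
          (simp add: power_mult_distrib ennreal_mult' mult.assoc)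
      also have "\<dots> = ennreal (exp (- r)) * (\<Sum>k. ennreal ((s * sqrt r) ^ (2 * k) / fact (2 * k)) * ?M k)"
        by (subst nn_integral_cmult) (auto simp: nn_integral_uniform_sphere_exp_moments)
      also have "\<dots> = (\<Sum>k. ennreal (exp (- r)) * (ennreal ((s * sqrt r) ^ (2 * k) / fact (2 * k)) * ?M k))"
        by simp
      also have "\<dots> = (\<Sum>k. ennreal (s ^ (2 * k) / fact (2 * k) * m k) * ennreal (r ^ k * exp (- r)))"
      proof (intro suminf_cong)
        fix k
        have pow: "(s * sqrt r) ^ (2 * k) = s ^ (2 * k) * r ^ k"
          using r by (simp add: power_mult_distrib power_mult)
        show "ennreal (exp (- r)) * (ennreal ((s * sqrt r) ^ (2 * k) / fact (2 * k)) * ?M k) =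
            ennreal (s ^ (2 * k) / fact (2 * k) * m k) * ennreal (r ^ k * exp (- r))"
          unfolding m(1) pow using r m(2)
          by (simp add: ennreal_mult'[symmetric] zero_le_even_power ac_simps)
      qed
      finally show "(\<integral>\<^sup>+v. ennreal (exp (- (norm (sqrt r *\<^sub>R v))\<^sup>2) * exp (s * (u \<bullet> (sqrt r *\<^sub>R v)))) \<partial>uniform_sphere) =
          (\<Sum>k. ennreal (s ^ (2 * k) / fact (2 * k) * m k) * ennreal (r ^ k * exp (- r)))" .
    qed
    also have "\<dots> = (\<Sum>k. ennreal (s ^ (2 * k) / fact (2 * k) * m k) * ennreal (pi powr (?d / 2) * P k))"
      by (subst nn_integral_suminf, simp) (simp add: nn_integral_cmult nn_integral_sq_norm_measure_exp P_def)
    also have "\<dots> = (\<Sum>k. ennreal (pi powr (?d / 2) * (s ^ (2 * k) / fact (2 * k) * m k * P k)))"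
      using m(2) less_imp_le[OF P] by (intro suminf_cong) (simp add: ennreal_mult'[symmetric] zero_le_even_power ac_simps)
    finally show ?thesis .
  qed
  have "m k * P k / fact (2 * k) = 1 / (4 ^ k * fact k)" for k
  proof (rule powser_sums_unique)
    \<comment> \<open>The series is taken at \<open>s = sqrt y\<close>, which turns even powers of
      \<open>s\<close> into all powers of \<open>y\<close>.\<close>
    fix y :: real assume y: "y \<ge> 0"
    let ?f = "\<lambda>k. pi powr (?d / 2) * (y ^ k / fact (2 * k) * m k * P k)"
    have pow: "sqrt y ^ (2 * k) = y ^ k" for k
      using y by (simp add: power_mult)
    have series_y: "ennreal (pi powr (?d / 2) * exp (y / 4)) = (\<Sum>k. ennreal (?f k))"
      using series[of "sqrt y"] unfolding pow real_sqrt_pow2[OF y] .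
    have pos: "?f k \<ge> 0" for k
      using m(2) less_imp_le[OF P[of k]] y by simp
    have sm: "summable ?f"
      using pos by (rule summable_suminf_not_top) (unfold series_y[symmetric], simp)
    then have "ennreal (suminf ?f) = ennreal (pi powr (?d / 2) * exp (y / 4))"
      unfolding series_y using pos by (intro suminf_ennreal2[symmetric])
    then have "suminf ?f = pi powr (?d / 2) * exp (y / 4)"
      using pos sm by (subst (asm) ennreal_inj) (auto intro: suminf_nonneg)
    then have "?f sums (pi powr (?d / 2) * exp (y / 4))"
      using sm by (simp add: sums_iff)
    from sums_divide[OF this, of "pi powr (?d / 2)"]
    show "(\<lambda>k. m k * P k / fact (2 * k) * y ^ k) sums exp (y / 4)"
      by (simp add: ac_simps)
    show "(\<lambda>k. 1 / (4 ^ k * fact k) * y ^ k) sums exp (y / 4)"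
    proof -
      have "1 / (4 ^ k * fact k) * y ^ k = (y / 4) ^ k /\<^sub>R fact k" for k
        by (simp add: power_divide field_simps)
      then show ?thesis by (simp only: exp_converges)
    qed
  qed
  note coeff = this
  have "s ^ (2 * k) / fact (2 * k) * m k = (s\<^sup>2 / 4) ^ k / (fact k * P k)" for k
  proof -
    have "s ^ (2 * k) / fact (2 * k) * m k = s ^ (2 * k) * (m k * P k / fact (2 * k)) / P k"
      using P[of k] by simp
    then show ?thesis
      unfolding coeff by (simp add: power_divide power_mult)
  qed
  then have "ennreal (s ^ (2 * k) / fact (2 * k)) * ?M k = ennreal ((s\<^sup>2 / 4) ^ k / (fact k * P k))" for k
    unfolding m(1) using m(2) by (simp add: ennreal_mult'[symmetric] zero_le_even_power)
  then show ?thesis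
    by (simp add: nn_integral_uniform_sphere_exp_moments bessel_def P_def)
qed

lemma nn_integral_uniform_sphere_exp:
  fixes w :: "real ^ 'd"
  shows "(\<integral>\<^sup>+v. ennreal (exp (w \<bullet> v)) \<partial>uniform_sphere) = bessel (CARD('d) / 2) (norm w)"
proof -
  obtain u :: "real ^ 'd" where u: "norm u = 1" "w = norm w *\<^sub>R u"
  proof (cases "w = 0")
    \<comment> \<open>For \<open>w = 0\<close> any unit vector serves as direction.\<close>
    case True
    then show ?thesis using that[of "axis undefined 1"] by (simp add: norm_axis_1)
  next
    case False
    then show ?thesis using that[of "sgn w"] by (simp add: norm_sgn sgn_div_norm)
  qed
  then have "w \<bullet> v = norm w * (u \<bullet> v)" for v
    by (metis inner_scaleR_left)
  then show ?thesis
    using nn_integral_uniform_sphere_exp_unit[OF u(1)] by simp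
qed

subsection \<open>The convolution semigroup of Bessel kernels\<close>

lemma suminf_swap_ennreal:
  fixes f :: "nat \<Rightarrow> nat \<Rightarrow> ennreal"
  shows "(\<Sum>i. \<Sum>j. f i j) = (\<Sum>j. \<Sum>i. f i j)"
proof -
  have "(\<Sum>i. \<Sum>j. f i j) = (\<integral>\<^sup>+i. (\<Sum>j. f i j) \<partial>count_space UNIV)"
    by (simp add: nn_integral_count_space_nat)
  also have "\<dots> = (\<Sum>j. \<Sum>i. f i j)"
    by (subst nn_integral_suminf) (auto simp: nn_integral_count_space_nat)
  finally show ?thesis .
qed

lemma suminf_diagonal_ennreal:
  fixes f :: "nat \<Rightarrow> nat \<Rightarrow> ennreal"
  shows "(\<Sum>i. \<Sum>j. f i j) = (\<Sum>k. \<Sum>i\<le>k. f i (k - i))"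
proof -
  \<comment> \<open>Row \<open>i\<close> is shifted right by \<open>i\<close> and padded with zeros,
    so that the columns become the diagonals of \<open>f\<close>.\<close>
  let ?g = "\<lambda>i k. if i \<le> k then f i (k - i) else 0"
  have "(\<Sum>k. ?g i k) = (\<Sum>j. f i j)" for i
    using suminf_offset[of "?g i" i] by (simp add: summableI)
  moreover have "(\<Sum>i. ?g i k) = (\<Sum>i\<le>k. f i (k - i))" for k
    by (subst suminf_finite[of "{..k}"]) auto
  ultimately show ?thesis
    using suminf_swap_ennreal[of ?g] by simp
qed

lemma nn_integral_Beta:
  assumes "a > 0" "b > 0" "t > 0"
  shows "(\<integral>\<^sup>+s. ennreal (indicator {0<..<t} s * (s powr (a - 1) * (t - s) powr (b - 1))) \<partial>lborel) =
    ennreal (t powr (a + b - 1) * Beta a b)"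
proof -
  let ?f = "\<lambda>x. x powr (a - 1) * (1 - x) powr (b - 1)"
  have "((\<lambda>x. indicator {0..1} x * ?f x) has_integral Beta a b) UNIV"
    using has_integral_Beta_real[OF assms(1,2)]
    by (subst (asm) has_integral_restrict_UNIV[symmetric], elim has_integral_eq[rotated]) auto
  then have beta: "(\<integral>\<^sup>+x. ennreal (indicator {0..1} x * ?f x) \<partial>lborel) = ennreal (Beta a b)"
    by (intro nn_integral_has_integral_lborel) (auto simp: indicator_def)
  have "(\<integral>\<^sup>+s. ennreal (indicator {0<..<t} s * (s powr (a - 1) * (t - s) powr (b - 1))) \<partial>lborel) =
      ennreal t * (\<integral>\<^sup>+x. ennreal (indicator {0<..<t} (t * x) * ((t * x) powr (a - 1) * (t - t * x) powr (b - 1))) \<partial>lborel)"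
    using assms by (subst nn_integral_real_affine[where c = t and t = 0]) auto
  also have "(\<integral>\<^sup>+x. ennreal (indicator {0<..<t} (t * x) * ((t * x) powr (a - 1) * (t - t * x) powr (b - 1))) \<partial>lborel) =
      (\<integral>\<^sup>+x. ennreal (t powr (a + b - 2)) * ennreal (indicator {0..1} x * ?f x) \<partial>lborel)"
  proof (intro nn_integral_cong_AE)
    have "AE x in lborel. x \<noteq> 0 \<and> x \<noteq> (1::real)"
      using AE_lborel_singleton[of 0] AE_lborel_singleton[of 1] by eventually_elim simp
    then show "AE x in lborel. ennreal (indicator {0<..<t} (t * x) * ((t * x) powr (a - 1) * (t - t * x) powr (b - 1))) =
        ennreal (t powr (a + b - 2)) * ennreal (indicator {0..1} x * ?f x)"
    proof eventually_elim
      case (elim x)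
      have "(t * x) powr (a - 1) * (t - t * x) powr (b - 1) = t powr (a + b - 2) * ?f x" if "0 < x" "x < 1"
      proof -
        have "t - t * x = t * (1 - x)" by (simp add: algebra_simps)
        moreover have "t powr (a + b - 2) = t powr (a - 1) * t powr (b - 1)"
          by (simp flip: powr_add)
        ultimately show ?thesis
          using assms that by (simp add: powr_mult)
      qed
      then show ?case
        using elim assms by (auto simp: indicator_def ennreal_mult'[symmetric] mult_less_0_iff zero_less_mult_iff)
    qed
  qed
  also have "\<dots> = ennreal (t powr (a + b - 2)) * ennreal (Beta a b)"
    by (subst nn_integral_cmult) (auto simp: beta)
  finally have "(\<integral>\<^sup>+s. ennreal (indicator {0<..<t} s * (s powr (a - 1) * (t - s) powr (b - 1))) \<partial>lborel) =
      ennreal t * (ennreal (t powr (a + b - 2)) * ennreal (Beta a b))" .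
  moreover have "t * t powr (a + b - 2) = t powr (a + b - 1)"
    using assms powr_add[of t 1 "a + b - 2"] by simp
  ultimately show ?thesis
    using assms by (simp add: ennreal_mult'[symmetric] mult.assoc[symmetric])
qed

text \<open>The Riemann-Liouville kernel of fractional integration of order \<open>a\<close>.
  Extension by zero makes convolution over the whole line the convolution over
  \<open>{0<..<t}\<close>.\<close>

definition riesz :: "real \<Rightarrow> real \<Rightarrow> real" where
  "riesz a s = (if s > 0 then s powr (a - 1) / Gamma a else 0)"

lemma riesz_measurable [measurable]: "riesz a \<in> borel_measurable borel"
  unfolding riesz_def by measurable

lemma riesz_nonneg: "a > 0 \<Longrightarrow> riesz a s \<ge> 0"
  by (simp add: riesz_def)

text \<open>With the normalisation by \<open>Gamma\<close>, the Beta integral is exactly the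
  semigroup law.\<close>

lemma nn_integral_riesz_convolution:
  assumes a: "a > 0" and b: "b > 0"
  shows "(\<integral>\<^sup>+s. ennreal (riesz a s) * ennreal (riesz b (t - s)) \<partial>lborel) = ennreal (riesz (a + b) t)"
proof (cases "t > 0")
  case True
  have "(\<integral>\<^sup>+s. ennreal (riesz a s) * ennreal (riesz b (t - s)) \<partial>lborel) =
      (\<integral>\<^sup>+s. ennreal (1 / (Gamma a * Gamma b)) *
        ennreal (indicator {0<..<t} s * (s powr (a - 1) * (t - s) powr (b - 1))) \<partial>lborel)"
    using assms by (intro nn_integral_cong) (auto simp: riesz_def indicator_def ennreal_mult'[symmetric])
  also have "\<dots> = ennreal (1 / (Gamma a * Gamma b)) * ennreal (t powr (a + b - 1) * Beta a b)"
    using assms True by (subst nn_integral_cmult) (auto simp: nn_integral_Beta)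
  also have "\<dots> = ennreal (riesz (a + b) t)"
    using True Gamma_real_pos[OF a] Gamma_real_pos[OF b]
    by (subst ennreal_mult'[symmetric]) (auto simp: riesz_def Beta_def)
  finally show ?thesis .
next
  case False
  then have "(\<integral>\<^sup>+s. ennreal (riesz a s) * ennreal (riesz b (t - s)) \<partial>lborel) = (\<integral>\<^sup>+s. 0 \<partial>(lborel :: real measure))"
    by (intro nn_integral_cong) (auto simp: riesz_def)
  then show ?thesis using False by (simp add: riesz_def)
qed

text \<open>\<open>flight_weight q a k\<close> is, up to the factor \<open>(r\<^sup>2 / 4) ^ k\<close>, the coefficient of \<open>riesz (a + 2 k)\<close> in
  the kernel \<open>riesz a s * bessel (q a) (r * s)\<close>; since the functions \<open>riesz a\<close> form a convolution
  semigroup, so do these kernels as soon as the weights are additive in the following sense.\<close>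

definition flight_weight :: "(real \<Rightarrow> real) \<Rightarrow> real \<Rightarrow> nat \<Rightarrow> real" where
  "flight_weight q a k = pochhammer a (2 * k) / (fact k * pochhammer (q a) k)"

definition convolution_index :: "(real \<Rightarrow> real) \<Rightarrow> bool" where
  "convolution_index q \<longleftrightarrow> (\<forall>a>0. q a > 0) \<and>
    (\<forall>a>0. \<forall>b>0. \<forall>k. (\<Sum>i\<le>k. flight_weight q a i * flight_weight q b (k - i)) = flight_weight q (a + b) k)"

text \<open>\<open>q a = d / 2\<close> holds for \<open>a = d - 1\<close> with the first index and for \<open>a = d / 2 - 1\<close> with the second:
  these are the two models.\<close>

lemma convolution_index_first: "convolution_index (\<lambda>a. (a + 1) / 2)"
proof -
  \<comment> \<open>The duplication formula splits \<open>pochhammer a (2 * k)\<close> into factors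
    at \<open>a / 2\<close> and \<open>(a + 1) / 2\<close>; the second cancels the
    denominator.\<close>
  have w: "flight_weight (\<lambda>a. (a + 1) / 2) a k = 4 ^ k * (pochhammer (a / 2) k / fact k)" if "a > 0" for a k
    using pochhammer_double[of "a / 2" k] pochhammer_pos[of "(a + 1) / 2" k] that
    by (simp add: flight_weight_def power_mult add_divide_distrib)
  have "(\<Sum>i\<le>k. flight_weight (\<lambda>a. (a + 1) / 2) a i * flight_weight (\<lambda>a. (a + 1) / 2) b (k - i)) =
      flight_weight (\<lambda>a. (a + 1) / 2) (a + b) k" if "a > 0" "b > 0" for a b k
  proof -
    have "(\<Sum>i\<le>k. flight_weight (\<lambda>a. (a + 1) / 2) a i * flight_weight (\<lambda>a. (a + 1) / 2) b (k - i)) =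
        (\<Sum>i\<le>k. 4 ^ k * (pochhammer (a / 2) i / fact i * (pochhammer (b / 2) (k - i) / fact (k - i))))"
      using that by (intro sum.cong refl) (simp add: w power_add[symmetric] mult_ac flip: power_add)
    also have "\<dots> = 4 ^ k * (pochhammer ((a + b) / 2) k / fact k)"
      by (simp only: sum_distrib_left[symmetric] vandermonde_pochhammer add_divide_distrib)
    also have "\<dots> = flight_weight (\<lambda>a. (a + 1) / 2) (a + b) k"
      using that by (simp only: w add_pos_pos)
    finally show ?thesis .
  qed
  then show ?thesis by (auto simp: convolution_index_def)
qed

lemma convolution_index_second: "convolution_index (\<lambda>a. a + 1)"
proof -
  have w: "flight_weight (\<lambda>a. a + 1) a k = rothe k a" if "a > 0" for a k
    using that by (simp add: flight_weight_def rothe_pochhammer)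
  then show ?thesis by (auto simp: convolution_index_def rothe_hagen)
qed

text \<open>With \<open>r = c * norm w\<close> and \<open>q a = d / 2\<close> this is the
  contribution of one displacement of duration \<open>s\<close>: its factor in the density of the
  durations times the Laplace transform of its direction.\<close>

definition flight_kernel :: "(real \<Rightarrow> real) \<Rightarrow> real \<Rightarrow> real \<Rightarrow> real \<Rightarrow> ennreal" where
  "flight_kernel q r a s = ennreal (riesz a s) * bessel (q a) (r * s)"

lemma bessel_measurable [measurable]: "bessel q \<in> borel_measurable borel"
  unfolding bessel_def by measurable

lemma flight_kernel_measurable [measurable]: "flight_kernel q r a \<in> borel_measurable borel"
  unfolding flight_kernel_def by measurable

lemma flight_weight_nonneg:
  "convolution_index q \<Longrightarrow> a > 0 \<Longrightarrow> flight_weight q a k \<ge> 0"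
  by (auto simp: flight_weight_def convolution_index_def intro!: divide_nonneg_nonneg mult_nonneg_nonneg pochhammer_nonneg)

text \<open>Since \<open>pochhammer a (2 * k)\<close> is \<open>Gamma (a + 2 * k) / Gamma a\<close>,
  multiplying \<open>riesz a s\<close> by \<open>s ^ (2 * k)\<close> gives that multiple of
  \<open>riesz (a + 2 * k) s\<close>.\<close>

lemma flight_kernel_series:
  assumes q: "convolution_index q" and a: "a > 0"
  shows "flight_kernel q r a s =
    (\<Sum>k. ennreal ((r\<^sup>2 / 4) ^ k * flight_weight q a k) * ennreal (riesz (a + 2 * real k) s))"
proof -
  have "ennreal (riesz a s) * ennreal (((r * s)\<^sup>2 / 4) ^ k / (fact k * pochhammer (q a) k)) =
      ennreal ((r\<^sup>2 / 4) ^ k * flight_weight q a k) * ennreal (riesz (a + 2 * real k) s)" for k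
  proof (cases "s > 0")
    case True
    have "x \<notin> \<int>\<^sub>\<le>\<^sub>0" if "x > 0" for x :: real
      using that by (auto elim!: nonpos_Ints_cases)
    then have "pochhammer a (2 * k) = Gamma (a + 2 * real k) / Gamma a"
      using pochhammer_Gamma[of a "2 * k"] a by simp
    moreover have "Gamma (a + 2 * real k) > 0" "Gamma a > 0"
      using a by (auto intro!: Gamma_real_pos)
    ultimately have G: "pochhammer a (2 * k) / Gamma (a + 2 * real k) = 1 / Gamma a"
      by (simp add: field_simps)
    have "s powr (a + 2 * real k - 1) = s powr (a - 1) * (s\<^sup>2) ^ k"
      using True powr_add[of s "a - 1" "2 * real k"] powr_realpow[of s "2 * k"]
      by (simp add: algebra_simps flip: power_mult)
    then have "riesz a s * (((r * s)\<^sup>2 / 4) ^ k / (fact k * pochhammer (q a) k)) =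
        (r\<^sup>2 / 4) ^ k * (s powr (a + 2 * real k - 1)) / (fact k * pochhammer (q a) k) * (1 / Gamma a)"
      using True by (simp add: riesz_def power_mult_distrib power_divide power_mult mult_ac)
    also have "\<dots> = (r\<^sup>2 / 4) ^ k * flight_weight q a k * riesz (a + 2 * real k) s"
      unfolding G[symmetric] using True by (simp add: riesz_def flight_weight_def)
    finally show ?thesis
      using a q by (simp add: ennreal_mult'[symmetric] riesz_nonneg flight_weight_nonneg)
  qed (simp add: riesz_def)
  then show ?thesis
    by (simp add: flight_kernel_def bessel_def flip: ennreal_suminf_cmult)
qed

text \<open>The two series are multiplied and integrated term by term. By the semigroup law of
  \<open>riesz\<close> the integral depends on \<open>i + j\<close> only, so the weights can be
  summed along diagonals, where \<open>convolution_index\<close> applies.\<close>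

lemma flight_kernel_convolution:
  assumes q: "convolution_index q" and a: "a > 0" and b: "b > 0"
  shows "(\<integral>\<^sup>+s. flight_kernel q r a s * flight_kernel q r b (t - s) \<partial>lborel) = flight_kernel q r (a + b) t"
proof -
  define c where "c a k = (r\<^sup>2 / 4) ^ k * flight_weight q a k" for a k
  have c: "c a k \<ge> 0" if "a > 0" for a k
    using flight_weight_nonneg[OF q that] by (simp add: c_def)
  have "(\<integral>\<^sup>+s. flight_kernel q r a s * flight_kernel q r b (t - s) \<partial>lborel) =
      (\<integral>\<^sup>+s. (\<Sum>i. \<Sum>j. ennreal (c a i * c b j) *
        (ennreal (riesz (a + 2 * real i) s) * ennreal (riesz (b + 2 * real j) (t - s)))) \<partial>lborel)"
  proof (rule nn_integral_cong)
    fix s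
    have ab: "flight_kernel q r a s = (\<Sum>i. ennreal (c a i) * ennreal (riesz (a + 2 * real i) s))"
      "flight_kernel q r b (t - s) = (\<Sum>j. ennreal (c b j) * ennreal (riesz (b + 2 * real j) (t - s)))"
      using a b by (simp_all add: flight_kernel_series[OF q] c_def)
    have prod_suminf: "(\<Sum>i. F i) * (\<Sum>j. G j) = (\<Sum>i. \<Sum>j. F i * G j)" for F G :: "nat \<Rightarrow> ennreal"
      by simp
    show "flight_kernel q r a s * flight_kernel q r b (t - s) = (\<Sum>i. \<Sum>j. ennreal (c a i * c b j) *
        (ennreal (riesz (a + 2 * real i) s) * ennreal (riesz (b + 2 * real j) (t - s))))"
      unfolding ab prod_suminf using c[OF a] c[OF b] by (intro suminf_cong) (simp add: ennreal_mult mult_ac)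
  qed
  also have "\<dots> = (\<Sum>i. \<Sum>j. ennreal (c a i * c b j) *
      (\<integral>\<^sup>+s. ennreal (riesz (a + 2 * real i) s) * ennreal (riesz (b + 2 * real j) (t - s)) \<partial>lborel))"
    by (simp add: nn_integral_suminf nn_integral_cmult)
  also have "\<dots> = (\<Sum>i. \<Sum>j. ennreal (c a i * c b j) * ennreal (riesz (a + b + 2 * real (i + j)) t))"
    using a b by (simp add: nn_integral_riesz_convolution algebra_simps)
  also have "\<dots> = (\<Sum>k. \<Sum>i\<le>k. ennreal (c a i * c b (k - i)) * ennreal (riesz (a + b + 2 * real (i + (k - i))) t))"
    by (rule suminf_diagonal_ennreal)
  also have "\<dots> = (\<Sum>k. ennreal (c (a + b) k) * ennreal (riesz (a + b + 2 * real k) t))"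
  proof (intro suminf_cong)
    fix k
    have "(\<Sum>i\<le>k. ennreal (c a i * c b (k - i)) * ennreal (riesz (a + b + 2 * real (i + (k - i))) t)) =
        (\<Sum>i\<le>k. ennreal (c a i * c b (k - i))) * ennreal (riesz (a + b + 2 * real k) t)"
      by (subst sum_distrib_right) (intro sum.cong refl, simp)
    also have "(\<Sum>i\<le>k. ennreal (c a i * c b (k - i))) = ennreal (\<Sum>i\<le>k. c a i * c b (k - i))"
      using c[OF a] c[OF b] by (intro sum_ennreal) auto
    also have "(\<Sum>i\<le>k. c a i * c b (k - i)) =
        (\<Sum>i\<le>k. (r\<^sup>2 / 4) ^ k * (flight_weight q a i * flight_weight q b (k - i)))"
      by (intro sum.cong refl) (simp add: c_def mult_ac flip: power_add)
    also have "\<dots> = c (a + b) k"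
      using q a b by (simp add: sum_distrib_left[symmetric] c_def convolution_index_def)
    finally show "(\<Sum>i\<le>k. ennreal (c a i * c b (k - i)) * ennreal (riesz (a + b + 2 * real (i + (k - i))) t)) =
        ennreal (c (a + b) k) * ennreal (riesz (a + b + 2 * real k) t)" .
  qed
  also have "\<dots> = flight_kernel q r (a + b) t"
    using a b by (simp add: flight_kernel_series[OF q] c_def)
  finally show ?thesis .
qed

subsection \<open>The Laplace transform of a flight with a fixed number of changes of direction\<close>

text \<open>Induction on \<open>n\<close>: with the duration \<open>y\<close> of index
  \<open>Suc n\<close> fixed, the others form a configuration with total time \<open>t - y\<close>,
  and integration over \<open>y\<close> is one more convolution. The time is kept arbitrary because
  \<open>t - y\<close> may be negative.\<close>

lemma nn_integral_flight_kernel_prod: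
  assumes q: "convolution_index q" and a: "a > 0"
  shows "(\<integral>\<^sup>+\<tau>. (\<Prod>j\<in>{1..n+1}. flight_kernel q r a (duration t n \<tau> j)) \<partial>(\<Pi>\<^sub>M j\<in>{1..n}. lborel)) =
    flight_kernel q r ((real n + 1) * a) t"
proof (induction n arbitrary: t)
  case 0
  interpret product_sigma_finite "\<lambda>_. lborel :: real measure" ..
  show ?case by (simp add: duration_def PiM_empty nn_integral_count_space_finite)
next
  case (Suc n)
  interpret product_sigma_finite "\<lambda>_. lborel :: real measure" ..
  let ?K = "flight_kernel q r a"
  let ?f = "\<lambda>\<tau>. \<Prod>j\<in>{1..Suc n + 1}. ?K (duration t (Suc n) \<tau> j)"
  have I: "{1..Suc n} = insert (Suc n) {1..n}" by auto
  have f: "?f \<in> borel_measurable (\<Pi>\<^sub>M j\<in>{1..Suc n}. lborel)"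
    by (intro borel_measurable_prod_ennreal measurable_compose[OF measurable_duration]) auto
  have split: "?f (x(Suc n := y)) = ?K y * (\<Prod>j\<in>{1..n+1}. ?K (duration (t - y) n x j))" for x y
  proof -
    have s: "(\<Sum>i\<in>{1..n}. (x(Suc n := y)) i) = (\<Sum>i\<in>{1..n}. x i)"
      by (intro sum.cong) auto
    have p: "(\<Prod>j\<in>{1..n}. ?K (duration t (Suc n) (x(Suc n := y)) j)) = (\<Prod>j\<in>{1..n}. ?K (duration (t - y) n x j))"
      by (intro prod.cong refl) (auto simp: duration_def)
    have e: "{1..Suc n + 1} = insert (n + 2) (insert (n + 1) {1..n})" "{1..n+1} = insert (n + 1) {1..n}"
      by auto
    \<comment> \<open>Index \<open>n + 1\<close> now carries the free duration \<open>y\<close>; the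
      remainder moves to index \<open>n + 2\<close> and equals the remainder of the shorter
      configuration at \<open>n + 1\<close>.\<close>
    have d: "duration t (Suc n) (x(Suc n := y)) (n + 1) = y"
      "duration t (Suc n) (x(Suc n := y)) (n + 2) = duration (t - y) n x (n + 1)"
      using s by (simp_all add: duration_def I del: fun_upd_apply) simp_all
    show ?thesis
      unfolding e using p d by (simp add: mult_ac del: fun_upd_apply)
  qed
  have "(\<integral>\<^sup>+\<tau>. ?f \<tau> \<partial>(\<Pi>\<^sub>M j\<in>{1..Suc n}. lborel)) =
      (\<integral>\<^sup>+y. (\<integral>\<^sup>+x. ?f (x(Suc n := y)) \<partial>(\<Pi>\<^sub>M j\<in>{1..n}. lborel)) \<partial>lborel)"
    unfolding I by (rule product_nn_integral_insert_rev) (simp, simp, fact f[unfolded I])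
  also have "\<dots> = (\<integral>\<^sup>+y. ?K y * flight_kernel q r ((real n + 1) * a) (t - y) \<partial>lborel)"
  proof (intro nn_integral_cong)
    fix y
    have "(\<lambda>x. \<Prod>j\<in>{1..n+1}. ?K (duration (t - y) n x j)) \<in> borel_measurable (\<Pi>\<^sub>M j\<in>{1..n}. lborel)"
      by (intro borel_measurable_prod_ennreal measurable_compose[OF measurable_duration]) auto
    then show "(\<integral>\<^sup>+x. ?f (x(Suc n := y)) \<partial>(\<Pi>\<^sub>M j\<in>{1..n}. lborel)) =
        ?K y * flight_kernel q r ((real n + 1) * a) (t - y)"
      unfolding split by (simp only: nn_integral_cmult Suc.IH)
  qed
  also have "\<dots> = flight_kernel q r (a + (real n + 1) * a) t"
    using a by (intro flight_kernel_convolution[OF q]) auto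
  also have "a + (real n + 1) * a = (real (Suc n) + 1) * a"
    by (simp add: algebra_simps)
  finally show ?case .
qed

lemma prob_space_uniform_spheres:
  "prob_space (\<Pi>\<^sub>M j\<in>I. (uniform_sphere :: (real ^ 'd) measure))"
  by (intro prob_space_PiM prob_space_uniform_sphere)

lemma nn_integral_flight_law:
  assumes [measurable]: "F \<in> borel_measurable borel"
  shows "(\<integral>\<^sup>+x. F x \<partial>(flight_law a c t n :: (real ^ 'd) measure)) =
    (\<integral>\<^sup>+\<tau>. ennreal (durations_density a t n \<tau>) *
      (\<integral>\<^sup>+v. F (flight_position c t n \<tau> v) \<partial>(\<Pi>\<^sub>M j\<in>{1..n+1}. uniform_sphere))
      \<partial>(\<Pi>\<^sub>M j\<in>{1..n}. lborel))"
proof -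
  let ?V = "\<Pi>\<^sub>M j\<in>{1..n+1}. (uniform_sphere :: (real ^ 'd) measure)"
  let ?T = "durations_law a t n"
  interpret V: prob_space ?V by (rule prob_space_uniform_spheres)
  note F = measurable_compose[OF measurable_flight_position assms, of c t n a]
  have "(\<integral>\<^sup>+x. F x \<partial>(flight_law a c t n :: (real ^ 'd) measure)) =
      (\<integral>\<^sup>+p. F ((\<lambda>(\<tau>, v). flight_position c t n \<tau> v) p) \<partial>(?T \<Otimes>\<^sub>M ?V))"
    unfolding flight_law_def by (rule nn_integral_distr[OF measurable_flight_position]) simp
  also have "\<dots> = (\<integral>\<^sup>+\<tau>. (\<integral>\<^sup>+v. F (flight_position c t n \<tau> v) \<partial>?V) \<partial>?T)"
    using V.nn_integral_fst[OF F] by simp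
  also have "\<dots> = (\<integral>\<^sup>+\<tau>. ennreal (durations_density a t n \<tau>) * (\<integral>\<^sup>+v. F (flight_position c t n \<tau> v) \<partial>?V)
      \<partial>(\<Pi>\<^sub>M j\<in>{1..n}. lborel))"
  proof -
    have "(\<lambda>\<tau>. \<integral>\<^sup>+v. F (flight_position c t n \<tau> v) \<partial>?V) \<in> borel_measurable ?T"
      using V.borel_measurable_nn_integral_fst[OF F] by simp
    then have "(\<lambda>\<tau>. \<integral>\<^sup>+v. F (flight_position c t n \<tau> v) \<partial>?V) \<in> borel_measurable (\<Pi>\<^sub>M j\<in>{1..n}. lborel)"
      by (simp add: durations_law_def)
    then show ?thesis
      unfolding durations_law_def
      by (intro nn_integral_density measurable_compose[OF measurable_durations_density measurable_ennreal])
  qed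
  finally show ?thesis .
qed

lemma durations_density_nonzero:
  assumes "durations_density a t n \<tau> \<noteq> 0" "j \<in> {1..n+1}"
  shows "duration t n \<tau> j > 0"
  using assms by (auto simp: durations_density_def duration_def split: if_splits)

lemma sum_duration: "(\<Sum>j\<in>{1..n+1}. duration t n \<tau> j) = t"
proof -
  have "(\<Sum>j\<in>{1..n+1}. duration t n \<tau> j) = (\<Sum>j\<in>{1..n}. duration t n \<tau> j) + duration t n \<tau> (n + 1)"
    by simp
  also have "(\<Sum>j\<in>{1..n}. duration t n \<tau> j) = (\<Sum>j\<in>{1..n}. \<tau> j)"
    by (intro sum.cong) (auto simp: duration_def)
  finally show ?thesis by (simp add: duration_def)
qed

text \<open>For given durations the exponential factorises over the independent directions, each
  factor giving a Bessel series. Together with the Dirichlet density this is a constant times a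
  product of kernels, so the iterated convolution evaluates it.\<close>

lemma nn_integral_flight_law_exp:
  fixes w :: "real ^ 'd"
  assumes q: "convolution_index q" and a: "a > 0" and qa: "q a = real CARD('d) / 2"
    and c: "c > 0" and t: "t > 0"
  shows "(\<integral>\<^sup>+x. ennreal (exp (w \<bullet> x)) \<partial>flight_law a c t n) =
    bessel (q ((real n + 1) * a)) (c * t * norm w)"
proof -
  let ?V = "\<Pi>\<^sub>M j\<in>{1..n+1}. (uniform_sphere :: (real ^ 'd) measure)"
  let ?K = "flight_kernel q (c * norm w) a"
  define A where "A = (real n + 1) * a"
  have A: "A > 0" using a by (simp add: A_def)
  interpret product_sigma_finite "\<lambda>_. uniform_sphere :: (real ^ 'd) measure"
    by (intro product_sigma_finite.intro prob_space_imp_sigma_finite prob_space_uniform_sphere)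
  have inner: "(\<integral>\<^sup>+v. ennreal (exp (w \<bullet> flight_position c t n \<tau> v)) \<partial>?V) =
      (\<Prod>j\<in>{1..n+1}. bessel (q a) (c * norm w * duration t n \<tau> j))" for \<tau>
  proof -
    have "exp (w \<bullet> flight_position c t n \<tau> v) = (\<Prod>j\<in>{1..n+1}. exp ((c * duration t n \<tau> j) *\<^sub>R w \<bullet> v j))" for v
      by (subst exp_sum[symmetric])
        (auto simp: flight_position_def inner_sum_right sum_distrib_left mult_ac simp del: sum.cl_ivl_Suc)
    then have "(\<integral>\<^sup>+v. ennreal (exp (w \<bullet> flight_position c t n \<tau> v)) \<partial>?V) =
        (\<integral>\<^sup>+v. (\<Prod>j\<in>{1..n+1}. ennreal (exp ((c * duration t n \<tau> j) *\<^sub>R w \<bullet> v j))) \<partial>?V)"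
      by (simp only: prod_ennreal exp_ge_zero)
    also have "\<dots> = (\<Prod>j\<in>{1..n+1}. \<integral>\<^sup>+v. ennreal (exp ((c * duration t n \<tau> j) *\<^sub>R w \<bullet> v)) \<partial>uniform_sphere)"
      by (rule product_nn_integral_prod) auto
    also have "\<dots> = (\<Prod>j\<in>{1..n+1}. bessel (q a) (c * norm w * duration t n \<tau> j))"
      using c by (intro prod.cong refl)
        (simp only: nn_integral_uniform_sphere_exp, simp add: bessel_def qa abs_mult power_mult_distrib mult_ac)
    finally show ?thesis .
  qed
  \<comment> \<open>Outside the simplex some duration, possibly the remainder, is nonpositive; then
    its kernel vanishes, and so does the density.\<close>
  have pointwise: "ennreal (durations_density a t n \<tau>) * (\<Prod>j\<in>{1..n+1}. bessel (q a) (c * norm w * duration t n \<tau> j)) =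
      ennreal (Gamma A / t powr (A - 1)) * (\<Prod>j\<in>{1..n+1}. ?K (duration t n \<tau> j))" for \<tau>
  proof (cases "(\<forall>j\<in>{1..n}. \<tau> j > 0) \<and> (\<Sum>j\<in>{1..n}. \<tau> j) < t")
    case True
    then have pos: "duration t n \<tau> j > 0" if "j \<in> {1..n+1}" for j
      using that by (auto simp: duration_def)
    have riesz_prod: "(\<Prod>j\<in>{1..n+1}. riesz a (duration t n \<tau> j)) =
        (\<Prod>j\<in>{1..n+1}. duration t n \<tau> j powr (a - 1)) / Gamma a ^ (n + 1)"
    proof -
      have "(\<Prod>j\<in>{1..n+1}. riesz a (duration t n \<tau> j)) = (\<Prod>j\<in>{1..n+1}. duration t n \<tau> j powr (a - 1) / Gamma a)"
        using pos by (intro prod.cong refl) (simp add: riesz_def)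
      also have "\<dots> = (\<Prod>j\<in>{1..n+1}. duration t n \<tau> j powr (a - 1)) / Gamma a ^ (n + 1)"
        by (subst prod_dividef) simp
      finally show ?thesis .
    qed
    have dens: "durations_density a t n \<tau> = Gamma A / t powr (A - 1) * (\<Prod>j\<in>{1..n+1}. riesz a (duration t n \<tau> j))"
      unfolding durations_density_def A_def[symmetric] if_P[OF True] riesz_prod
      by (simp only: times_divide_eq_left times_divide_eq_right mult_1 mult_1_right divide_divide_eq_left divide_divide_eq_right mult_ac)
    have "(\<Prod>j\<in>{1..n+1}. ?K (duration t n \<tau> j)) =
        ennreal (\<Prod>j\<in>{1..n+1}. riesz a (duration t n \<tau> j)) * (\<Prod>j\<in>{1..n+1}. bessel (q a) (c * norm w * duration t n \<tau> j))"
      unfolding flight_kernel_def prod.distrib using a by (subst prod_ennreal) (auto simp: riesz_nonneg)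
    moreover have "(\<Prod>j\<in>{1..n+1}. riesz a (duration t n \<tau> j)) \<ge> 0"
      using a by (intro prod_nonneg) (simp add: riesz_nonneg)
    moreover have "Gamma A / t powr (A - 1) \<ge> 0"
      using A by simp
    ultimately show ?thesis
      unfolding dens by (simp only: ennreal_mult mult.assoc)
  next
    case False
    then obtain j where j: "j \<in> {1..n+1}" "duration t n \<tau> j \<le> 0"
    proof (cases "\<forall>j\<in>{1..n}. \<tau> j > 0")
      case True
      then show ?thesis
        using False that[of "n + 1"] by (auto simp: duration_def)
    next
      case False
      then obtain j where "j \<in> {1..n}" "\<tau> j \<le> 0" by (auto simp: not_less)
      then show ?thesis
        using that[of j] by (auto simp: duration_def)
    qed
    then have "?K (duration t n \<tau> j) = 0"
      by (simp add: flight_kernel_def riesz_def)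
    then have "(\<Prod>j\<in>{1..n+1}. ?K (duration t n \<tau> j)) = 0"
      using j(1) by (intro prod_zero) auto
    moreover have "durations_density a t n \<tau> = 0"
      by (simp only: durations_density_def if_not_P[OF False])
    ultimately show ?thesis by simp
  qed
  have K: "(\<lambda>\<tau>. \<Prod>j\<in>{1..n+1}. ?K (duration t n \<tau> j)) \<in> borel_measurable (\<Pi>\<^sub>M j\<in>{1..n}. lborel)"
    by (intro borel_measurable_prod_ennreal measurable_compose[OF measurable_duration]) auto
  have "(\<integral>\<^sup>+x. ennreal (exp (w \<bullet> x)) \<partial>flight_law a c t n) =
      (\<integral>\<^sup>+\<tau>. ennreal (Gamma A / t powr (A - 1)) * (\<Prod>j\<in>{1..n+1}. ?K (duration t n \<tau> j)) \<partial>(\<Pi>\<^sub>M j\<in>{1..n}. lborel))"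
    by (subst nn_integral_flight_law) (auto simp only: inner pointwise, measurable)
  also have "\<dots> = ennreal (Gamma A / t powr (A - 1)) * flight_kernel q (c * norm w) A t"
    using K by (simp only: nn_integral_cmult nn_integral_flight_kernel_prod[OF q a] A_def)
  also have "\<dots> = ennreal (Gamma A / t powr (A - 1) * riesz A t) * bessel (q A) (c * norm w * t)"
    using A by (subst ennreal_mult) (auto simp: flight_kernel_def mult.assoc riesz_nonneg)
  \<comment> \<open>The Dirichlet normalisation is exactly the reciprocal of
    \<open>riesz A t\<close>.\<close>
  also have "Gamma A / t powr (A - 1) * riesz A t = 1"
    using Gamma_real_pos[OF A] t by (simp add: riesz_def)
  finally show ?thesis by (simp add: A_def mult_ac)
qed

section \<open>The support of the law of the position\<close>

lemma AE_uniform_spheres: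
  assumes "finite I"
  shows "AE v in (\<Pi>\<^sub>M j\<in>I. (uniform_sphere :: (real ^ 'd) measure)). \<forall>j\<in>I. norm (v j) = 1"
  using assms by (intro AE_finite_allI AE_PiM_component AE_uniform_sphere prob_space_uniform_sphere)

text \<open>Triangle inequality: the directions are unit vectors and the durations are positive with
  sum \<open>t\<close>.\<close>

lemma emeasure_flight_law_outside:
  assumes c: "c > 0"
  shows "emeasure (flight_law a c t n :: (real ^ 'd) measure) (- cball 0 (c * t)) = 0"
proof -
  let ?V = "\<Pi>\<^sub>M j\<in>{1..n+1}. (uniform_sphere :: (real ^ 'd) measure)"
  have zero: "(\<integral>\<^sup>+v. indicator (- cball 0 (c * t)) (flight_position c t n \<tau> v :: real ^ 'd) \<partial>?V) = 0"
    if d: "durations_density a t n \<tau> \<noteq> 0" for \<tau>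
  proof -
    have "AE v in ?V. indicator (- cball 0 (c * t)) (flight_position c t n \<tau> v) = (0 :: ennreal)"
      using AE_uniform_spheres[OF finite_atLeastAtMost]
    proof (eventually_elim)
      case (elim v)
      have "norm (flight_position c t n \<tau> v) \<le> c * (\<Sum>j\<in>{1..n+1}. norm (duration t n \<tau> j *\<^sub>R v j))"
        using c unfolding flight_position_def norm_scaleR[of c] by (intro mult_mono norm_sum) auto
      also have "(\<Sum>j\<in>{1..n+1}. norm (duration t n \<tau> j *\<^sub>R v j)) = (\<Sum>j\<in>{1..n+1}. duration t n \<tau> j)"
        using elim durations_density_nonzero[OF d] by (intro sum.cong refl) (auto simp: less_imp_le)
      finally show ?case by (simp only: sum_duration) simp
    qed
    then have "(\<integral>\<^sup>+v. indicator (- cball 0 (c * t)) (flight_position c t n \<tau> v :: real ^ 'd) \<partial>?V) = (\<integral>\<^sup>+v. 0 \<partial>?V)"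
      by (rule nn_integral_cong_AE)
    then show ?thesis by simp
  qed
  have "emeasure (flight_law a c t n :: (real ^ 'd) measure) (- cball 0 (c * t)) =
      (\<integral>\<^sup>+x. indicator (- cball 0 (c * t)) x \<partial>(flight_law a c t n :: (real ^ 'd) measure))"
    by (simp add: flight_law_def)
  also have "\<dots> = (\<integral>\<^sup>+\<tau>. 0 \<partial>(\<Pi>\<^sub>M j\<in>{1..n}. (lborel :: real measure)))"
    by (subst nn_integral_flight_law, simp) (intro nn_integral_cong, use zero in force)
  finally show ?thesis by simp
qed

lemma emeasure_flight_law_0:
  assumes c: "c > 0" and t: "t > 0"
  shows "emeasure (flight_law a c t 0 :: (real ^ 'd) measure) (- sphere 0 (c * t)) = 0"
proof -
  let ?V = "\<Pi>\<^sub>M j\<in>{1..0+1::nat}. (uniform_sphere :: (real ^ 'd) measure)"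
  have zero: "(\<integral>\<^sup>+v. indicator (- sphere 0 (c * t)) (flight_position c t 0 \<tau> v :: real ^ 'd) \<partial>?V) = 0" for \<tau>
  proof -
    have "AE v in ?V. indicator (- sphere 0 (c * t)) (flight_position c t 0 \<tau> v) = (0 :: ennreal)"
      using AE_uniform_spheres[OF finite_atLeastAtMost]
    proof eventually_elim
      case (elim v)
      then have "norm (flight_position c t 0 \<tau> v) = c * t"
        using c t by (simp add: flight_position_def duration_def)
      then show ?case by simp
    qed
    then have "(\<integral>\<^sup>+v. indicator (- sphere 0 (c * t)) (flight_position c t 0 \<tau> v :: real ^ 'd) \<partial>?V) = (\<integral>\<^sup>+v. 0 \<partial>?V)"
      by (rule nn_integral_cong_AE)
    then show ?thesis by simp
  qed
  have "emeasure (flight_law a c t 0 :: (real ^ 'd) measure) (- sphere 0 (c * t)) =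
      (\<integral>\<^sup>+x. indicator (- sphere 0 (c * t)) x \<partial>(flight_law a c t 0 :: (real ^ 'd) measure))"
    by (simp add: flight_law_def borel_closed)
  also have "\<dots> = (\<integral>\<^sup>+\<tau>. 0 \<partial>(\<Pi>\<^sub>M j\<in>{1..0::nat}. (lborel :: real measure)))"
    by (subst nn_integral_flight_law, simp add: borel_closed) (intro nn_integral_cong, simp only: zero mult_zero_right)
  finally show ?thesis by simp
qed

subsection \<open>Uniqueness of the Laplace transform under bounded support\<close>

text \<open>Linear combinations of exponentials form an algebra, to which Stone-Weierstrass applies.\<close>

inductive_set exp_span :: "('a :: euclidean_space \<Rightarrow> real) set" where
  base: "(\<lambda>x. c * exp (w \<bullet> x)) \<in> exp_span"
| add: "f \<in> exp_span \<Longrightarrow> g \<in> exp_span \<Longrightarrow> (\<lambda>x. f x + g x) \<in> exp_span"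

lemma exp_span_continuous: "f \<in> exp_span \<Longrightarrow> continuous_on S f"
  by (induction rule: exp_span.induct) (auto intro!: continuous_intros)

lemma exp_span_const: "(\<lambda>_. c) \<in> exp_span"
  using exp_span.base[of c 0] by simp

lemma exp_span_mult:
  assumes "f \<in> exp_span" "g \<in> exp_span"
  shows "(\<lambda>x. f x * g x) \<in> exp_span"
  using assms(1)
proof induction
  case (base c w)
  show ?case
    using assms(2)
  proof induction
    case (base c' w')
    have "(\<lambda>x. c * exp (w \<bullet> x) * (c' * exp (w' \<bullet> x))) = (\<lambda>x. (c * c') * exp ((w + w') \<bullet> x))"
      by (simp add: inner_add_left exp_add mult_ac)
    then show ?case
      using exp_span.base[of "c * c'" "w + w'"] by metis
  next
    case (add f g)
    then show ?case
      using exp_span.add by (simp add: distrib_left)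
  qed
next
  case (add f g)
  then show ?case
    using exp_span.add by (simp add: distrib_right)
qed

lemma exp_span_dense:
  fixes f :: "'a :: euclidean_space \<Rightarrow> real"
  assumes "compact S" "continuous_on S f" "e > 0"
  shows "\<exists>g\<in>exp_span. \<forall>x\<in>S. \<bar>f x - g x\<bar> < e"
proof -
  interpret function_ring_on exp_span S
  proof
    fix x y :: 'a assume "x \<noteq> y"
    \<comment> \<open>The exponential with direction \<open>x - y\<close> separates \<open>x\<close>
      from \<open>y\<close>, since the two inner products differ by the squared distance.\<close>
    then have "(x - y) \<bullet> x \<noteq> (x - y) \<bullet> y"
      by (metis eq_iff_diff_eq_0 inner_diff_right inner_eq_zero_iff)
    then show "\<exists>f\<in>exp_span. f x \<noteq> f y"
      by (intro bexI[OF _ exp_span.base[of 1 "x - y"]]) simp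
  qed (use assms in \<open>auto intro: exp_span_continuous exp_span.add exp_span_mult exp_span_const\<close>)
  show ?thesis
    using Stone_Weierstrass_basic[OF assms(2,3)] .
qed

lemma integrable_continuous_bounded_support:
  fixes M :: "'a :: euclidean_space measure" and f :: "'a \<Rightarrow> real"
  assumes "finite_measure M" and M: "sets M = sets borel" "emeasure M (- cball 0 R) = 0"
    and f: "continuous_on UNIV f"
  shows "integrable M f"
proof -
  interpret finite_measure M by fact
  have "compact (f ` cball 0 R)"
    using f by (intro compact_continuous_image) (auto intro: continuous_on_subset)
  then obtain B where "\<forall>x\<in>cball 0 R. norm (f x) \<le> B"
    by (meson bounded_iff compact_imp_bounded image_eqI)
  moreover have "AE x in M. x \<in> cball 0 R"
    using M by (intro AE_I[of _ _ "- cball 0 R"]) auto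
  ultimately have "AE x in M. norm (f x) \<le> B"
    by (auto elim: eventually_mono)
  then show ?thesis
    using borel_measurable_continuous_onI[OF f] M(1)
    by (intro integrable_const_bound) (auto cong: measurable_cong_sets)
qed

text \<open>The indicator of a nonempty closed set \<open>C\<close> is the bounded pointwise limit
  of the continuous functions \<open>max 0 (1 - n * infdist x C)\<close>, and the closed sets are an
  intersection-stable generator.\<close>

lemma measure_eqI_integral_continuous:
  fixes M N :: "'a :: euclidean_space measure"
  assumes "finite_measure M" "finite_measure N" and sets: "sets M = sets borel" "sets N = sets borel"
    and eq: "\<And>f :: 'a \<Rightarrow> real. continuous_on UNIV f \<Longrightarrow> integral\<^sup>L M f = integral\<^sup>L N f"
  shows "M = N"
proof -
  interpret M: finite_measure M by fact
  interpret N: finite_measure N by fact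
  have lim: "(\<lambda>n. integral\<^sup>L K (\<lambda>x. max 0 (1 - real n * infdist x C))) \<longlonglongrightarrow> measure K C"
    if "finite_measure K" and K: "sets K = sets borel" and C: "closed C" "C \<noteq> {}"
    for K :: "'a measure" and C
  proof -
    interpret K: finite_measure K by fact
    note [measurable_cong] = K
    have [measurable]: "(\<lambda>x. infdist x C) \<in> borel_measurable borel"
      by (intro borel_measurable_continuous_onI continuous_on_infdist continuous_on_id)
    have C_sets [measurable]: "C \<in> sets borel"
      using C by simp
    have "(\<lambda>n. integral\<^sup>L K (\<lambda>x. max 0 (1 - real n * infdist x C))) \<longlonglongrightarrow> integral\<^sup>L K (indicator C :: 'a \<Rightarrow> real)"
    proof (rule integral_dominated_convergence[where w = "\<lambda>_. 1"])
      show "AE x in K. (\<lambda>n. max 0 (1 - real n * infdist x C)) \<longlonglongrightarrow> indicator C x"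
      proof (intro AE_I2)
        fix x
        show "(\<lambda>n. max 0 (1 - real n * infdist x C)) \<longlonglongrightarrow> indicator C x"
        proof (cases "x \<in> C")
          case True
          then show ?thesis by simp
        next
          case False
          then have pos: "infdist x C > 0"
            using C by (metis in_closed_iff_infdist_zero infdist_nonneg order_less_le)
          obtain n0 :: nat where "1 / infdist x C < real n0"
            using reals_Archimedean2 by blast
          then have "max 0 (1 - real n * infdist x C) = 0" if "n \<ge> n0" for n
          proof -
            have "1 / infdist x C < real n"
              using \<open>1 / infdist x C < real n0\<close> that by linarith
            then show ?thesis
              using pos by (simp add: divide_less_eq)
          qed
          then have "eventually (\<lambda>n. max 0 (1 - real n * infdist x C) = 0) sequentially"
            by (auto simp: eventually_sequentially)
          then show ?thesis
            using False by (simp add: tendsto_eventually)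
        qed
      qed
      show "AE x in K. norm (max 0 (1 - real n * infdist x C)) \<le> 1" for n
        using infdist_nonneg[of _ C] by (intro AE_I2) (auto simp: max_def)
    qed auto
    then show ?thesis
      by (simp add: K sets_eq_imp_space_eq[OF K])
  qed
  have meas: "emeasure M C = emeasure N C" if "closed C" for C
  \<comment> \<open>\<open>infdist\<close> to the empty set is 0 by convention, so the approximation
    does not cover this case.\<close>
  proof (cases "C = {}")
    case False
    have "continuous_on UNIV (\<lambda>x. max 0 (1 - real n * infdist x C))" for n
      by (intro continuous_intros)
    then have "measure M C = measure N C"
      using LIMSEQ_unique[OF lim[OF \<open>finite_measure M\<close> sets(1) that False]]
        lim[OF \<open>finite_measure N\<close> sets(2) that False] by (simp add: eq)
    then show ?thesis
      by (simp add: M.emeasure_eq_measure N.emeasure_eq_measure)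
  qed simp
  show ?thesis
  proof (rule measure_eqI_generator_eq[where E = "Collect closed" and \<Omega> = UNIV and A = "\<lambda>_. UNIV"])
    show "Int_stable (Collect closed :: 'a set set)"
      by (auto simp: Int_stable_def)
    have "sets borel = sigma_sets UNIV (Collect closed :: 'a set set)"
      by (subst borel_eq_closed) simp
    then show "sets M = sigma_sets UNIV (Collect closed)" "sets N = sigma_sets UNIV (Collect closed)"
      by (simp_all add: sets)
    show "emeasure M UNIV \<noteq> \<infinity>"
      using M.emeasure_finite by simp
  qed (use meas in auto)
qed

text \<open>The integrals agree on \<open>exp_span\<close>, which is uniformly dense on the ball
  carrying both measures, hence on all continuous functions.\<close>

lemma measure_eqI_exp:
  fixes M N :: "'a :: euclidean_space measure"
  assumes M: "finite_measure M" "sets M = sets borel" "emeasure M (- cball 0 R) = 0"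
    and N: "finite_measure N" "sets N = sets borel" "emeasure N (- cball 0 R) = 0"
    and eq: "\<And>w. (\<integral>\<^sup>+x. ennreal (exp (w \<bullet> x)) \<partial>M) = (\<integral>\<^sup>+x. ennreal (exp (w \<bullet> x)) \<partial>N)"
  shows "M = N"
proof (rule measure_eqI_integral_continuous)
  interpret M: finite_measure M by fact
  interpret N: finite_measure N by fact
  note intM = integrable_continuous_bounded_support[OF M]
    and intN = integrable_continuous_bounded_support[OF N]
  have span: "integral\<^sup>L M g = integral\<^sup>L N g" if "g \<in> exp_span" for g
    using that
  proof induction
    case (base c w)
    have "continuous_on UNIV (\<lambda>x::'a. exp (w \<bullet> x))"
      by (intro continuous_intros)
    then have "integral\<^sup>L M (\<lambda>x. exp (w \<bullet> x)) = integral\<^sup>L N (\<lambda>x. exp (w \<bullet> x))"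
      using eq[of w] nn_integral_eq_integral[OF intM] nn_integral_eq_integral[OF intN]
      by (simp add: integral_nonneg_AE)
    then show ?case by simp
  next
    case (add f g)
    then show ?case
      by (simp add: intM intN exp_span_continuous)
  qed
  fix f :: "'a \<Rightarrow> real" assume f: "continuous_on UNIV f"
  define B where "B = measure M UNIV + measure N UNIV"
  have approx: "\<bar>integral\<^sup>L K f - integral\<^sup>L K g\<bar> \<le> e * measure K UNIV"
    if "finite_measure K" "sets K = sets borel" "emeasure K (- cball 0 R) = 0"
      and g: "continuous_on UNIV g" "\<forall>x\<in>cball 0 R. \<bar>f x - g x\<bar> < e" for K :: "'a measure" and g e
  proof -
    interpret K: finite_measure K by fact
    note intK = integrable_continuous_bounded_support[OF that(1-3)]
    have "AE x in K. x \<in> cball 0 R"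
      using that by (intro AE_I[of _ _ "- cball 0 R"]) auto
    then have ae: "AE x in K. norm (f x - g x) \<le> e"
      using g(2) by (auto elim!: eventually_mono simp: less_imp_le)
    have "\<bar>integral\<^sup>L K f - integral\<^sup>L K g\<bar> = norm (integral\<^sup>L K (\<lambda>x. f x - g x))"
      using intK[OF f] intK[OF g(1)] by simp
    also have "\<dots> \<le> integral\<^sup>L K (\<lambda>x. norm (f x - g x))"
      by (rule integral_norm_bound)
    also have "\<dots> \<le> integral\<^sup>L K (\<lambda>x. e)"
      using intK[OF f] intK[OF g(1)] ae by (intro integral_mono_AE) auto
    also have "\<dots> = e * measure K UNIV"
      using sets_eq_imp_space_eq[OF that(2)] by simp
    finally show ?thesis .
  qed
  have "\<bar>integral\<^sup>L M f - integral\<^sup>L N f\<bar> \<le> e * B" if "e > 0" for e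
  proof -
    obtain g where g: "g \<in> exp_span" "\<forall>x\<in>cball 0 R. \<bar>f x - g x\<bar> < e"
      using exp_span_dense[OF compact_cball _ \<open>e > 0\<close>] continuous_on_subset[OF f] by (metis subset_UNIV)
    note gc = exp_span_continuous[OF g(1)]
    show ?thesis
      using approx[OF M gc g(2)] approx[OF N gc g(2)] span[OF g(1)]
      by (simp add: B_def distrib_left)
  qed
  moreover have "B \<ge> 0" by (simp add: B_def)
  ultimately have "\<bar>integral\<^sup>L M f - integral\<^sup>L N f\<bar> \<le> 0 + e" if "e > 0" for e
  proof -
    \<comment> \<open>The summand 1 keeps the denominator positive even if both measures are
      zero.\<close>
    have "e / (B + 1) > 0" using that \<open>B \<ge> 0\<close> by simp
    then have "\<bar>integral\<^sup>L M f - integral\<^sup>L N f\<bar> \<le> e / (B + 1) * B"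
      using \<open>\<And>e. e > 0 \<Longrightarrow> \<bar>integral\<^sup>L M f - integral\<^sup>L N f\<bar> \<le> e * B\<close> by blast
    also have "\<dots> \<le> e"
      using that \<open>B \<ge> 0\<close> by (simp add: divide_le_eq algebra_simps)
    finally show ?thesis by simp
  qed
  then show "integral\<^sup>L M f = integral\<^sup>L N f"
    using field_le_epsilon[of "\<bar>integral\<^sup>L M f - integral\<^sup>L N f\<bar>" 0] by simp
qed (use M N in auto)

subsection \<open>The density of a flight with a fixed number of changes of direction\<close>

text \<open>The counterpart of \<open>flight_kernel_series\<close> in the squared radius
  \<open>u\<close>. The order of \<open>riesz\<close> equals the Bessel parameter, so the rising
  factorials cancel and only \<open>1 / fact k\<close> remains.\<close>

lemma riesz_bessel:
  assumes b: "b > 0"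
  shows "ennreal (riesz b u) * bessel b (sqrt u * s) =
    (\<Sum>k. ennreal ((s\<^sup>2 / 4) ^ k / fact k) * ennreal (riesz (b + real k) u))"
proof -
  have "ennreal (riesz b u) * ennreal (((sqrt u * s)\<^sup>2 / 4) ^ k / (fact k * pochhammer b k)) =
      ennreal ((s\<^sup>2 / 4) ^ k / fact k) * ennreal (riesz (b + real k) u)" for k
  proof (cases "u > 0")
    case True
    have "b \<notin> \<int>\<^sub>\<le>\<^sub>0"
      using b by (auto elim!: nonpos_Ints_cases)
    then have "pochhammer b k = Gamma (b + real k) / Gamma b"
      by (rule pochhammer_Gamma)
    moreover have "Gamma b > 0" "Gamma (b + real k) > 0"
      using b by (auto intro!: Gamma_real_pos)
    moreover have "u powr (b + real k - 1) = u powr (b - 1) * u ^ k"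
      using True powr_add[of u "b - 1" "real k"] by (simp add: powr_realpow algebra_simps)
    ultimately have "riesz b u * (((sqrt u * s)\<^sup>2 / 4) ^ k / (fact k * pochhammer b k)) =
        (s\<^sup>2 / 4) ^ k / fact k * riesz (b + real k) u"
      using True by (simp add: riesz_def power_mult_distrib power_divide mult_ac)
    then show ?thesis
      using b by (simp add: ennreal_mult'[symmetric] riesz_nonneg)
  qed (simp add: riesz_def)
  then show ?thesis
    by (simp add: bessel_def flip: ennreal_suminf_cmult)
qed

text \<open>The density vanishes outside the ball because \<open>riesz\<close> vanishes at nonpositive arguments.\<close>

definition ball_density :: "real \<Rightarrow> real \<Rightarrow> real ^ 'd \<Rightarrow> real" where
  "ball_density p r x = Gamma (real CARD('d) / 2 + p) / (pi powr (CARD('d) / 2) * r powr (real CARD('d) + 2 * p - 2)) *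
    riesz p (r\<^sup>2 - (norm x)\<^sup>2)"

lemma ball_density_measurable [measurable]: "ball_density p r \<in> borel_measurable borel"
  unfolding ball_density_def by measurable

text \<open>In the squared radius the transform is a convolution at \<open>r\<^sup>2\<close>: each
  \<open>riesz (b + k)\<close> meets \<open>riesz p\<close> and becomes
  \<open>riesz (b + p + k)\<close>. Read backwards, \<open>riesz_bessel\<close> gives the Bessel
  series with parameter \<open>b + p\<close>.\<close>

lemma nn_integral_ball_density_exp:
  fixes w :: "real ^ 'd"
  assumes p: "p > 0" and r: "r > 0"
  shows "(\<integral>\<^sup>+x. ennreal (exp (w \<bullet> x)) \<partial>density lborel (\<lambda>x. ennreal (ball_density p r x))) =
    bessel (CARD('d) / 2 + p) (r * norm w)"
proof -
  define b where "b = real CARD('d) / 2"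
  define C where "C = Gamma (b + p) / r powr (2 * (b + p - 1))"
  have b: "b > 0" by (simp add: b_def)
  have C: "C \<ge> 0" using b p by (simp add: C_def)
  have D: "ball_density p r x = C / pi powr b * riesz p (r\<^sup>2 - (norm x)\<^sup>2)" for x :: "real ^ 'd"
  proof -
    have "real CARD('d) + 2 * p - 2 = 2 * (b + p - 1)" by (simp add: b_def)
    then show ?thesis by (simp only: ball_density_def C_def b_def[symmetric]) simp
  qed
  have "(\<integral>\<^sup>+x. ennreal (exp (w \<bullet> x)) \<partial>density lborel (\<lambda>x. ennreal (ball_density p r x))) =
      (\<integral>\<^sup>+x. ennreal (ball_density p r x) * ennreal (exp (w \<bullet> x)) \<partial>lborel)"
    by (rule nn_integral_density) auto
  also have "\<dots> = (\<integral>\<^sup>+u. (\<integral>\<^sup>+v. ennreal (ball_density p r (sqrt u *\<^sub>R v)) * ennreal (exp (w \<bullet> (sqrt u *\<^sub>R v)))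
      \<partial>(uniform_sphere :: (real ^ 'd) measure)) \<partial>sq_norm_measure CARD('d))"
    by (rule nn_integral_polar) measurable
  also have "\<dots> = (\<integral>\<^sup>+u. ennreal (C / pi powr b * riesz p (r\<^sup>2 - u)) * bessel b (sqrt u * norm w) \<partial>sq_norm_measure CARD('d))"
  proof (intro nn_integral_cong_AE eventually_mono[OF AE_sq_norm_measure])
    fix u :: real assume u: "u > 0"
    have "(\<integral>\<^sup>+v. ennreal (ball_density p r (sqrt u *\<^sub>R v)) * ennreal (exp (w \<bullet> (sqrt u *\<^sub>R v)))
        \<partial>(uniform_sphere :: (real ^ 'd) measure)) =
        (\<integral>\<^sup>+v. ennreal (C / pi powr b * riesz p (r\<^sup>2 - u)) * ennreal (exp ((sqrt u *\<^sub>R w) \<bullet> v)) \<partial>uniform_sphere)"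
      using u by (intro nn_integral_cong_AE eventually_mono[OF AE_uniform_sphere]) (simp add: D power_mult_distrib)
    also have "\<dots> = ennreal (C / pi powr b * riesz p (r\<^sup>2 - u)) * bessel b (norm (sqrt u *\<^sub>R w))"
      by (subst nn_integral_cmult) (measurable, simp only: nn_integral_uniform_sphere_exp b_def)
    also have "norm (sqrt u *\<^sub>R w) = sqrt u * norm w"
      using u by simp
    finally show "(\<integral>\<^sup>+v. ennreal (ball_density p r (sqrt u *\<^sub>R v)) * ennreal (exp (w \<bullet> (sqrt u *\<^sub>R v)))
        \<partial>(uniform_sphere :: (real ^ 'd) measure)) =
        ennreal (C / pi powr b * riesz p (r\<^sup>2 - u)) * bessel b (sqrt u * norm w)" .
  qed
  also have "\<dots> = (\<integral>\<^sup>+u. ennreal C * (ennreal (riesz b u) * bessel b (sqrt u * norm w) * ennreal (riesz p (r\<^sup>2 - u))) \<partial>lborel)"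
  proof -
    have "(\<integral>\<^sup>+u. ennreal (C / pi powr b * riesz p (r\<^sup>2 - u)) * bessel b (sqrt u * norm w) \<partial>sq_norm_measure CARD('d)) =
        (\<integral>\<^sup>+u. ennreal (pi powr b * riesz b u) * (ennreal (C / pi powr b * riesz p (r\<^sup>2 - u)) * bessel b (sqrt u * norm w)) \<partial>lborel)"
      unfolding sq_norm_measure_def b_def[symmetric]
      by (subst nn_integral_density) (auto intro!: nn_integral_cong simp: indicator_def riesz_def)
    also have "\<dots> = (\<integral>\<^sup>+u. ennreal C * (ennreal (riesz b u) * bessel b (sqrt u * norm w) * ennreal (riesz p (r\<^sup>2 - u))) \<partial>lborel)"
    proof (intro nn_integral_cong)
      fix u
      have eq: "ennreal (pi powr b * riesz b u) * ennreal (C / pi powr b * riesz p (r\<^sup>2 - u)) =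
          ennreal C * ennreal (riesz b u) * ennreal (riesz p (r\<^sup>2 - u))"
        using C riesz_nonneg[OF b, of u] riesz_nonneg[OF p, of "r\<^sup>2 - u"]
        by (simp add: ennreal_mult'[symmetric])
      show "ennreal (pi powr b * riesz b u) * (ennreal (C / pi powr b * riesz p (r\<^sup>2 - u)) * bessel b (sqrt u * norm w)) =
          ennreal C * (ennreal (riesz b u) * bessel b (sqrt u * norm w) * ennreal (riesz p (r\<^sup>2 - u)))"
        unfolding mult.assoc[symmetric] eq by (simp only: mult_ac)
    qed
    finally show ?thesis .
  qed
  also have "\<dots> = ennreal C * (\<integral>\<^sup>+u. (\<Sum>k. ennreal (((norm w)\<^sup>2 / 4) ^ k / fact k) *
      (ennreal (riesz (b + real k) u) * ennreal (riesz p (r\<^sup>2 - u)))) \<partial>lborel)"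
    by (subst nn_integral_cmult, measurable)
      (simp add: riesz_bessel[OF b] mult.assoc flip: ennreal_suminf_multc)
  also have "\<dots> = ennreal C * (\<Sum>k. ennreal (((norm w)\<^sup>2 / 4) ^ k / fact k) * ennreal (riesz (b + p + real k) (r\<^sup>2)))"
    using b p by (simp add: nn_integral_suminf nn_integral_cmult nn_integral_riesz_convolution add_ac)
  also have "\<dots> = ennreal C * (ennreal (riesz (b + p) (r\<^sup>2)) * bessel (b + p) (sqrt (r\<^sup>2) * norm w))"
    using b p by (subst riesz_bessel) auto
  also have "\<dots> = ennreal (C * riesz (b + p) (r\<^sup>2)) * bessel (b + p) (r * norm w)"
    using C b p r by (subst ennreal_mult) (auto simp: riesz_nonneg mult.assoc)
  also have "C * riesz (b + p) (r\<^sup>2) = 1"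
  proof -
    have "(r\<^sup>2) powr (b + p - 1) = r powr (2 * (b + p - 1))"
      using r by (simp add: powr_powr flip: powr_numeral)
    moreover have "Gamma (b + p) > 0" using b p by simp
    ultimately show ?thesis using r by (simp add: riesz_def C_def)
  qed
  finally show ?thesis by (simp add: b_def)
qed

lemma flight_law_eq_density:
  assumes q: "convolution_index q" and a: "a > 0" and qa: "q a = real CARD('d) / 2"
    and p: "q ((real n + 1) * a) = real CARD('d) / 2 + p" "p > 0"
    and c: "c > 0" and t: "t > 0"
  shows "(flight_law a c t n :: (real ^ 'd) measure) = density lborel (\<lambda>x. ennreal (ball_density p (c * t) x))"
    (is "?L = ?D")
proof (rule measure_eqI_exp)
  have r: "c * t > 0" using c t by simp
  have exp_eq: "(\<integral>\<^sup>+x. ennreal (exp (w \<bullet> x)) \<partial>?L) = bessel (real CARD('d) / 2 + p) (c * t * norm w)"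
    "(\<integral>\<^sup>+x. ennreal (exp (w \<bullet> x)) \<partial>?D) = bessel (real CARD('d) / 2 + p) (c * t * norm w)" for w :: "real ^ 'd"
    using nn_integral_flight_law_exp[OF q a qa c t, where n = n] p nn_integral_ball_density_exp[OF p(2) r] by auto
  then show "(\<integral>\<^sup>+x. ennreal (exp (w \<bullet> x)) \<partial>?L) = (\<integral>\<^sup>+x. ennreal (exp (w \<bullet> x)) \<partial>?D)" for w :: "real ^ 'd"
    by simp
  show "finite_measure ?L" "finite_measure ?D"
    \<comment> \<open>At \<open>w = 0\<close> the common transform equals 1, which is the total
      mass.\<close>
    using exp_eq[of 0] by (auto intro!: finite_measureI)
  show "sets ?L = sets borel" "sets ?D = sets borel"
    by (simp_all add: flight_law_def)
  show "emeasure ?L (- cball 0 (c * t)) = 0"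
    by (rule emeasure_flight_law_outside[OF c])
  have "ennreal (ball_density p (c * t) x) * indicator (- cball 0 (c * t)) x = 0" for x :: "real ^ 'd"
  proof (cases "norm x > c * t")
    case True
    then have "(c * t)\<^sup>2 \<le> (norm x)\<^sup>2"
      using r by (intro power_mono) auto
    then show ?thesis
      by (simp add: ball_density_def riesz_def)
  qed (auto simp: indicator_def)
  then show "emeasure ?D (- cball 0 (c * t)) = 0"
    by (subst emeasure_density) (measurable, simp only: nn_integral_const mult_zero_left)
qed

subsection \<open>Randomizing the number of changes of direction\<close>

lemma Gamma_ge_powr:
  assumes s: "s \<ge> 1" and m: "m > 0"
  shows "m powr (s - 1) / exp (m + 1) \<le> Gamma (s :: real)"
proof -
  \<comment> \<open>Euler's integral is bounded below by its part over \<open>{m..m+1}\<close>. As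
    \<open>m\<close> is free, \<open>Gamma\<close> outgrows every geometric sequence.\<close>
  have "ennreal (m powr (s - 1) / exp (m + 1)) = (\<integral>\<^sup>+u. ennreal (m powr (s - 1) / exp (m + 1)) * indicator {m..m+1} u \<partial>lborel)"
    by (subst nn_integral_cmult_indicator) auto
  also have "\<dots> \<le> (\<integral>\<^sup>+u. ennreal (indicator {0..} u * u powr (s - 1) / exp u) \<partial>lborel)"
    using assms by (intro nn_integral_mono)
      (auto simp: indicator_def intro!: ennreal_leI frac_le powr_mono2)
  also have "\<dots> = ennreal (Gamma s)"
    using s by (intro Gamma_conv_nn_integral_real[symmetric]) auto
  finally show ?thesis
    using s by (subst (asm) ennreal_le_iff) auto
qed

lemma mittag_leffler_summable:
  assumes \<alpha>: "\<alpha> > 0" and \<beta>: "\<beta> > 0" and x: "x \<ge> 0"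
  shows "summable (\<lambda>k. x ^ k / Gamma (\<alpha> * real k + \<beta>))"
proof -
  \<comment> \<open>Any \<open>y > x\<close> works; \<open>m\<close> is chosen with
    \<open>m powr \<alpha> = y\<close>, so that the terms are eventually dominated by a geometric
    series of ratio \<open>x / y\<close>.\<close>
  define y where "y = 2 * x + 1"
  define m where "m = y powr (1 / \<alpha>)"
  define C where "C = exp (m + 1) / m powr (\<beta> - 1)"
  have y: "y > 0" "x / y < 1" using x by (auto simp: y_def)
  have m: "m > 0" using y by (simp add: m_def)
  have m_powr: "m powr \<alpha> = y"
    using \<alpha> y by (simp add: m_def powr_powr)
  show ?thesis
  proof (rule summable_comparison_test_ev)
    obtain k0 :: nat where "1 / \<alpha> < real k0"
      using reals_Archimedean2 by blast
    then have "\<alpha> * real k + \<beta> \<ge> 1" if "k \<ge> k0" for k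
    proof -
      have "1 / \<alpha> < real k" using \<open>1 / \<alpha> < real k0\<close> that by linarith
      then show ?thesis using \<alpha> \<beta> by (simp add: divide_less_eq mult.commute)
    qed
    then have "norm (x ^ k / Gamma (\<alpha> * real k + \<beta>)) \<le> C * (x / y) ^ k" if "k \<ge> k0" for k
    proof -
      have "m powr (\<alpha> * real k + \<beta> - 1) = m powr (\<alpha> * real k) * m powr (\<beta> - 1)"
        by (simp add: add_diff_eq flip: powr_add)
      also have "m powr (\<alpha> * real k) = y ^ k"
        using m_powr y by (simp add: powr_powr[symmetric] powr_realpow)
      finally have G: "y ^ k / C \<le> Gamma (\<alpha> * real k + \<beta>)"
        using Gamma_ge_powr[OF \<open>\<And>k. k \<ge> k0 \<Longrightarrow> \<alpha> * real k + \<beta> \<ge> 1\<close>[OF that] m] by (simp add: C_def)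
      have C: "C > 0" using m by (simp add: C_def)
      have "x ^ k / Gamma (\<alpha> * real k + \<beta>) \<le> x ^ k / (y ^ k / C)"
        using G C y x by (intro frac_le) auto
      moreover have "x ^ k / Gamma (\<alpha> * real k + \<beta>) \<ge> 0"
        using x \<alpha> \<beta> by (intro divide_nonneg_nonneg) (auto intro!: less_imp_le[OF Gamma_real_pos] add_nonneg_pos)
      ultimately show ?thesis
        by (simp add: power_divide mult.commute)
    qed
    then show "eventually (\<lambda>k. norm (x ^ k / Gamma (\<alpha> * real k + \<beta>)) \<le> C * (x / y) ^ k) sequentially"
      by (auto simp: eventually_sequentially)
    show "summable (\<lambda>k. C * (x / y) ^ k)"
      using x y by (intro summable_mult summable_geometric) auto
  qed
qed

lemma mittag_leffler_pos:
  assumes "\<alpha> > 0" "\<beta> > 0" "x > 0"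
  shows "mittag_leffler \<alpha> \<beta> x > 0"
  unfolding mittag_leffler_def using assms
  by (intro suminf_pos mittag_leffler_summable) (auto intro!: divide_pos_pos Gamma_real_pos add_nonneg_pos)

section \<open>The mixture over the number of changes of direction\<close>

lemma emeasure_randomized_flight:
  assumes rf: "randomized_flight M N X p L" and p: "\<And>n. p n > 0"
    and L: "\<And>n. finite_measure (L n)" and A: "A \<in> sets borel"
  shows "emeasure (distr M borel X) A = (\<Sum>n. ennreal (p n) * emeasure (L n) A)"
proof -
  interpret prob_space M using rf by (simp add: randomized_flight_def)
  have [measurable]: "N \<in> measurable M (count_space UNIV)" "X \<in> borel_measurable M" "A \<in> sets borel"
    using rf A by (auto simp: randomized_flight_def)
  let ?E = "\<lambda>n. {\<omega> \<in> space M. X \<omega> \<in> A \<and> N \<omega> = n}"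
  have E: "emeasure M (?E n) = ennreal (p n) * emeasure (L n) A" for n
  proof -
    interpret L: finite_measure "L n" by (rule L)
    have "prob {\<omega> \<in> space M. N \<omega> = n} = p n" "\<P>(\<omega> in M. X \<omega> \<in> A \<bar> N \<omega> = n) = measure (L n) A"
      using rf A by (auto simp: randomized_flight_def)
    \<comment> \<open>Positivity of \<open>p n\<close> lets the division in the conditional
      probability be undone.\<close>
    then have "prob (?E n) = p n * measure (L n) A"
      using p[of n] by (simp add: cond_prob_def field_simps)
    then show ?thesis
      using p[of n] by (simp add: emeasure_eq_measure L.emeasure_eq_measure ennreal_mult)
  qed
  have "emeasure (distr M borel X) A = emeasure M (\<Union>n. ?E n)"
    by (subst emeasure_distr) (auto intro!: arg_cong[where f = "emeasure M"])
  also have "\<dots> = (\<Sum>n. emeasure M (?E n))"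
    by (intro suminf_emeasure[symmetric]) (auto simp: disjoint_family_on_def)
  finally show ?thesis by (simp add: E)
qed

text \<open>The term \<open>n = 0\<close> of the mixture is carried by a Lebesgue null sphere and is
  the singular part; the others have densities. Both the Gamma arguments of the weights and the
  exponents of the densities grow by \<open>\<alpha>\<close> per change of direction, which makes
  the sum a Mittag-Leffler series.\<close>

lemma ac_component_randomized_flight:
  fixes X :: "'p \<Rightarrow> real ^ 'd"
  defines "d \<equiv> real CARD('d)"
  assumes rf: "randomized_flight P N X (fractional_poisson_prob \<alpha> (d / 2) \<mu>) L"
    and \<alpha>: "\<alpha> > 0" and \<mu>: "\<mu> > 0" and r: "r > 0"
    and L: "\<And>n. finite_measure (L n)" "\<And>n. sets (L n) = sets borel"
    and L_0: "emeasure (L 0) (- sphere 0 r) = 0"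
    and L_Suc: "\<And>n. L (Suc n) = density lborel (\<lambda>x. ennreal (ball_density (\<alpha> * real (Suc n)) r x))"
  shows "ac_component lborel (distr P borel X)
    (density lborel (\<lambda>x. ennreal
      (if norm x < r
       then \<mu> / pi powr (d / 2) *
            ((r\<^sup>2 - (norm x)\<^sup>2) powr (\<alpha> - 1) / r powr (d + 2 * \<alpha> - 2)) *
            (mittag_leffler \<alpha> \<alpha> (\<mu> * (r\<^sup>2 - (norm x)\<^sup>2) powr \<alpha> / r powr (2 * \<alpha>))
               / mittag_leffler \<alpha> (d / 2) \<mu>)
       else 0)))"
proof -
  define E where "E = mittag_leffler \<alpha> (d / 2) \<mu>"
  define p where "p = fractional_poisson_prob \<alpha> (d / 2) \<mu>"
  define g where "g x = (if norm x < r
       then \<mu> / pi powr (d / 2) *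
            ((r\<^sup>2 - (norm x)\<^sup>2) powr (\<alpha> - 1) / r powr (d + 2 * \<alpha> - 2)) *
            (mittag_leffler \<alpha> \<alpha> (\<mu> * (r\<^sup>2 - (norm x)\<^sup>2) powr \<alpha> / r powr (2 * \<alpha>)) / E)
       else 0)" for x :: "real ^ 'd"
  have d: "d > 0" by (simp add: d_def)
  have E: "E > 0" unfolding E_def using \<alpha> \<mu> d by (intro mittag_leffler_pos) auto
  have Gpos: "Gamma (\<alpha> * real n + \<beta>) > 0" if "\<beta> > 0" for n \<beta>
    using \<alpha> that by (intro Gamma_real_pos add_nonneg_pos) auto
  have p_pos: "p n > 0" for n
    using E \<mu> d Gpos[of "d / 2" n] by (simp add: p_def fractional_poisson_prob_def E_def[symmetric])
  have g: "(\<Sum>n. ennreal (p (Suc n)) * ennreal (ball_density (\<alpha> * real (Suc n)) r x)) = ennreal (g x)"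
    for x :: "real ^ 'd"
  proof (cases "norm x < r")
    case True
    define u where "u = r\<^sup>2 - (norm x)\<^sup>2"
    have u: "u > 0" using True by (simp add: u_def power_strict_mono)
    define K where "K = \<mu> / pi powr (d / 2) * (u powr (\<alpha> - 1) / r powr (d + 2 * \<alpha> - 2)) / E"
    define z where "z = \<mu> * u powr \<alpha> / r powr (2 * \<alpha>)"
    have z: "z \<ge> 0" using \<mu> by (simp add: z_def)
    have K: "K \<ge> 0" using \<mu> E by (simp add: K_def)
    \<comment> \<open>The Gamma value in the weight cancels the one normalising
      \<open>ball_density\<close>; what remains comes from \<open>riesz\<close>. The shift from
      \<open>Suc n\<close> to \<open>n\<close> makes \<open>\<alpha>\<close> the second
      Mittag-Leffler parameter and puts one factor \<open>\<mu>\<close> into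
      \<open>K\<close>.\<close>
    have term_eq: "p (Suc n) * ball_density (\<alpha> * real (Suc n)) r x = K * (z ^ n / Gamma (\<alpha> * real n + \<alpha>))" for n
    proof -
      have 1: "d / 2 + \<alpha> * real (Suc n) = \<alpha> * real (Suc n) + d / 2" by simp
      have 2: "r powr (d + 2 * (\<alpha> * real (Suc n)) - 2) = r powr (d + 2 * \<alpha> - 2) * (r powr (2 * \<alpha>)) ^ n"
      proof -
        have "d + 2 * (\<alpha> * real (Suc n)) - 2 = (d + 2 * \<alpha> - 2) + (2 * \<alpha>) * real n"
          by (simp add: algebra_simps)
        then show ?thesis
          using r by (simp only: powr_add powr_powr[symmetric]) (simp add: powr_realpow)
      qed
      have 3: "u powr (\<alpha> * real (Suc n) - 1) = u powr (\<alpha> - 1) * (u powr \<alpha>) ^ n"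
      proof -
        have "\<alpha> * real (Suc n) - 1 = (\<alpha> - 1) + \<alpha> * real n"
          by (simp add: algebra_simps)
        then show ?thesis
          using u by (simp only: powr_add powr_powr[symmetric]) (simp add: powr_realpow)
      qed
      have 4: "\<alpha> * real (Suc n) = \<alpha> * real n + \<alpha>"
        by (simp add: algebra_simps)
      have G: "Gamma (\<alpha> * real (Suc n) + d / 2) \<noteq> 0"
        using Gpos[of "d / 2" "Suc n"] d by simp
      have "p (Suc n) * ball_density (\<alpha> * real (Suc n)) r x =
          1 / E * (\<mu> ^ Suc n / Gamma (\<alpha> * real (Suc n) + d / 2)) *
          (Gamma (\<alpha> * real (Suc n) + d / 2) / (pi powr (d / 2) * (r powr (d + 2 * \<alpha> - 2) * (r powr (2 * \<alpha>)) ^ n)) *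
            (u powr (\<alpha> - 1) * (u powr \<alpha>) ^ n / Gamma (\<alpha> * real n + \<alpha>)))"
        unfolding ball_density_def p_def fractional_poisson_prob_def E_def[symmetric] d_def[symmetric] u_def[symmetric] riesz_def
          if_P[OF u] 1 2 3 unfolding 4 ..
      also have "\<dots> = K * (z ^ n / Gamma (\<alpha> * real n + \<alpha>))"
        using G by (simp add: K_def z_def power_mult_distrib power_divide mult_ac)
      finally show ?thesis .
    qed
    have "(\<lambda>n. K * (z ^ n / Gamma (\<alpha> * real n + \<alpha>))) sums (K * mittag_leffler \<alpha> \<alpha> z)"
      unfolding mittag_leffler_def using \<alpha> z by (intro sums_mult summable_sums mittag_leffler_summable)
    then have "(\<Sum>n. ennreal (K * (z ^ n / Gamma (\<alpha> * real n + \<alpha>)))) = ennreal (K * mittag_leffler \<alpha> \<alpha> z)"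
      using K z less_imp_le[OF Gpos[OF \<alpha>]] by (intro suminf_ennreal_eq) auto
    moreover have "ennreal (p (Suc n)) * ennreal (ball_density (\<alpha> * real (Suc n)) r x) =
        ennreal (K * (z ^ n / Gamma (\<alpha> * real n + \<alpha>)))" for n
      unfolding term_eq[symmetric] using p_pos[of "Suc n"] by (simp add: ennreal_mult')
    moreover have "K * mittag_leffler \<alpha> \<alpha> z = g x"
      using True by (simp add: g_def K_def z_def u_def)
    ultimately show ?thesis by (simp only:)
  next
    case False
    then have "r\<^sup>2 \<le> (norm x)\<^sup>2"
      using r by (intro power_mono) auto
    then show ?thesis
      using False by (simp add: ball_density_def riesz_def g_def)
  qed
  \<comment> \<open>Measurability is inherited from the series of ball densities.\<close>
  have g_meas: "(\<lambda>x. ennreal (g x)) \<in> borel_measurable lborel"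
    unfolding g[symmetric] by measurable
  let ?S = "scale_measure (ennreal (p 0)) (L 0)"
  have "emeasure (distr P borel X) B = emeasure (density lborel (\<lambda>x. ennreal (g x))) B + emeasure ?S B"
    if B: "B \<in> sets borel" for B
  proof -
    have "emeasure (density lborel (\<lambda>x. ennreal (g x))) B = (\<integral>\<^sup>+x. ennreal (g x) * indicator B x \<partial>lborel)"
      using g_meas B by (intro emeasure_density) auto
    also have "\<dots> = (\<Sum>n. \<integral>\<^sup>+x. ennreal (p (Suc n)) * (ennreal (ball_density (\<alpha> * real (Suc n)) r x) * indicator B x) \<partial>lborel)"
      unfolding g[symmetric] ennreal_suminf_multc[symmetric] mult.assoc
      using B by (intro nn_integral_suminf) auto
    also have "\<dots> = (\<Sum>n. ennreal (p (Suc n)) * emeasure (L (Suc n)) B)"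
      using B by (intro suminf_cong, subst nn_integral_cmult) (auto simp: L_Suc emeasure_density)
    finally show ?thesis
      using emeasure_randomized_flight[OF rf[folded p_def] p_pos L(1) B]
        suminf_offset[of "\<lambda>n. ennreal (p n) * emeasure (L n) B" 1]
      by (simp add: summableI)
  qed
  moreover have "mutually_singular lborel ?S"
    unfolding mutually_singular_def
  proof (intro conjI bexI)
    show "sets ?S = sets lborel" by (simp add: L)
    show "emeasure lborel (sphere 0 r :: (real ^ 'd) set) = 0"
      using negligible_sphere[of "0 :: real ^ 'd" r]
      by (auto simp: null_sets_completion_iff negligible_iff_null_sets)
    show "emeasure ?S (space lborel - sphere 0 r) = 0"
      using L_0 by (simp add: Compl_eq_Diff_UNIV)
  qed (simp add: borel_closed)
  moreover have "absolutely_continuous lborel (density lborel (\<lambda>x. ennreal (g x)))"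
    using g_meas by (rule absolutely_continuousI_density)
  ultimately show ?thesis
    unfolding ac_component_def g_def[symmetric] E_def[symmetric] by auto
qed

text \<open>The common form of both models: the Bessel parameter is affine in \<open>n\<close>, so
  the ball density has \<open>p = \<alpha> * n\<close>, and the value at \<open>n = 0\<close> is the
  parameter \<open>d / 2\<close> of a single direction.\<close>

lemma ac_component_flight:
  fixes X :: "'p \<Rightarrow> real ^ 'd"
  defines "d \<equiv> real CARD('d)"
  assumes rf: "randomized_flight P N X (fractional_poisson_prob \<alpha> (d / 2) \<mu>) (flight_law a c t)"
    and q: "convolution_index q" and a: "a > 0" and qa: "\<And>n. q ((real n + 1) * a) = d / 2 + \<alpha> * real n"
    and \<alpha>: "\<alpha> > 0" and \<mu>: "\<mu> > 0" and c: "c > 0" and t: "t > 0"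
  shows "ac_component lborel (distr P borel X)
    (density lborel (\<lambda>x. ennreal
      (if norm x < c * t
       then \<mu> / pi powr (d / 2) *
            ((c\<^sup>2 * t\<^sup>2 - (norm x)\<^sup>2) powr (\<alpha> - 1) / (c * t) powr (d + 2 * \<alpha> - 2)) *
            (mittag_leffler \<alpha> \<alpha> (\<mu> * (c\<^sup>2 * t\<^sup>2 - (norm x)\<^sup>2) powr \<alpha> / (c * t) powr (2 * \<alpha>))
               / mittag_leffler \<alpha> (d / 2) \<mu>)
       else 0)))"
  unfolding power_mult_distrib[symmetric] d_def
proof (rule ac_component_randomized_flight[OF rf[unfolded d_def] \<alpha> \<mu>])
  have qa0: "q a = real CARD('d) / 2"
    using qa[of 0] by (simp add: d_def)
  show "c * t > 0" using c t by simp
  show "finite_measure (flight_law a c t n :: (real ^ 'd) measure)" for n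
    using nn_integral_flight_law_exp[OF q a qa0 c t, of n 0]
    by (intro finite_measureI) simp
  show "sets (flight_law a c t n :: (real ^ 'd) measure) = sets borel" for n
    by (simp add: flight_law_def)
  show "emeasure (flight_law a c t 0 :: (real ^ 'd) measure) (- sphere 0 (c * t)) = 0"
    using c t by (rule emeasure_flight_law_0)
  show "(flight_law a c t (Suc n) :: (real ^ 'd) measure) =
      density lborel (\<lambda>x. ennreal (ball_density (\<alpha> * real (Suc n)) (c * t) x))" for n
    using qa[of "Suc n"] \<alpha> by (intro flight_law_eq_density[OF q a qa0 _ _ c t]) (auto simp: d_def)
qed

section \<open>The two models, with \<open>\<alpha> = (d - 1) / 2\<close> and
  \<open>\<alpha> = d / 2 - 1\<close>\<close>

theorem theorem5:
  fixes c lam t :: real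
    and P :: "'p measure" and N :: "'p \<Rightarrow> nat" and X :: "'p \<Rightarrow> real ^ 'd"
    and Q :: "'q measure" and K :: "'q \<Rightarrow> nat" and Y :: "'q \<Rightarrow> real ^ 'e"
  assumes "c > 0" "lam > 0" "t > 0"
  shows
    "(let d = real CARD('d) in
        CARD('d) \<ge> 2 \<and>
        randomized_flight P N X
          (fractional_poisson_prob ((d - 1) / 2) (d / 2) (lam * t)) (first_flight_law c t)
        \<longrightarrow>
        ac_component lborel (distr P borel X)
          (density lborel (\<lambda>x. ennreal
            (if norm x < c * t
             then lam * t / pi powr (d / 2) *
                  ((c\<^sup>2 * t\<^sup>2 - (norm x)\<^sup>2) powr ((d - 1) / 2 - 1)
                     / (c * t) powr (2 * (d - 1) - 1)) *
                  (mittag_leffler ((d - 1) / 2) ((d - 1) / 2)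
                     (lam * t * (c\<^sup>2 * t\<^sup>2 - (norm x)\<^sup>2) powr ((d - 1) / 2)
                        / (c * t) powr (d - 1))
                     / mittag_leffler ((d - 1) / 2) (d / 2) (lam * t))
             else 0))))
     \<and>
     (let d = real CARD('e) in
        CARD('e) \<ge> 3 \<and>
        randomized_flight Q K Y
          (fractional_poisson_prob (d / 2 - 1) (d / 2) (lam * t)) (second_flight_law c t)
        \<longrightarrow>
        ac_component lborel (distr Q borel Y)
          (density lborel (\<lambda>y. ennreal
            (if norm y < c * t
             then lam * t / pi powr (d / 2) *
                  ((c\<^sup>2 * t\<^sup>2 - (norm y)\<^sup>2) powr (d / 2 - 2)
                     / (c * t) powr (4 * (d / 2 - 1))) *
                  (mittag_leffler (d / 2 - 1) (d / 2 - 1)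
                     (lam * t * (c\<^sup>2 * t\<^sup>2 - (norm y)\<^sup>2) powr (d / 2 - 1)
                        / (c * t) powr (d - 2))
                     / mittag_leffler (d / 2 - 1) (d / 2) (lam * t))
             else 0))))"
  unfolding Let_def
proof (intro conjI impI; elim conjE)
  assume d: "2 \<le> CARD('d)"
    and rf: "randomized_flight P N X
      (fractional_poisson_prob ((real CARD('d) - 1) / 2) (real CARD('d) / 2) (lam * t)) (first_flight_law c t)"
  \<comment> \<open>The exponents are rewritten in terms of \<open>\<alpha> = (d - 1) / 2\<close> to
    match the common form.\<close>
  have exps: "2 * (real CARD('d) - 1) - 1 = real CARD('d) + 2 * ((real CARD('d) - 1) / 2) - 2"
    "(c * t) powr (real CARD('d) - 1) = (c * t) powr (2 * ((real CARD('d) - 1) / 2))"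
    by (simp_all add: diff_divide_distrib)
  show "ac_component lborel (distr P borel X)
          (density lborel (\<lambda>x. ennreal
            (if norm x < c * t
             then lam * t / pi powr (real CARD('d) / 2) *
                  ((c\<^sup>2 * t\<^sup>2 - (norm x)\<^sup>2) powr ((real CARD('d) - 1) / 2 - 1)
                     / (c * t) powr (2 * (real CARD('d) - 1) - 1)) *
                  (mittag_leffler ((real CARD('d) - 1) / 2) ((real CARD('d) - 1) / 2)
                     (lam * t * (c\<^sup>2 * t\<^sup>2 - (norm x)\<^sup>2) powr ((real CARD('d) - 1) / 2)
                        / (c * t) powr (real CARD('d) - 1))
                     / mittag_leffler ((real CARD('d) - 1) / 2) (real CARD('d) / 2) (lam * t))
             else 0)))"
    unfolding exps
  proof (rule ac_component_flight[OF rf[unfolded first_flight_law_def] convolution_index_first])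
    show "((real n + 1) * (real CARD('d) - 1) + 1) / 2 = real CARD('d) / 2 + (real CARD('d) - 1) / 2 * real n" for n
      by (simp add: field_simps)
  qed (use assms d in auto)
next
  assume d: "3 \<le> CARD('e)"
    and rf: "randomized_flight Q K Y
      (fractional_poisson_prob (real CARD('e) / 2 - 1) (real CARD('e) / 2) (lam * t)) (second_flight_law c t)"
  \<comment> \<open>The same with \<open>\<alpha> = d / 2 - 1\<close>, which here also equals the
    Dirichlet parameter.\<close>
  have exps: "4 * (real CARD('e) / 2 - 1) = real CARD('e) + 2 * (real CARD('e) / 2 - 1) - 2"
    "real CARD('e) / 2 - 2 = real CARD('e) / 2 - 1 - 1"
    "(c * t) powr (real CARD('e) - 2) = (c * t) powr (2 * (real CARD('e) / 2 - 1))"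
    by (simp_all add: diff_divide_distrib)
  show "ac_component lborel (distr Q borel Y)
          (density lborel (\<lambda>y. ennreal
            (if norm y < c * t
             then lam * t / pi powr (real CARD('e) / 2) *
                  ((c\<^sup>2 * t\<^sup>2 - (norm y)\<^sup>2) powr (real CARD('e) / 2 - 2)
                     / (c * t) powr (4 * (real CARD('e) / 2 - 1))) *
                  (mittag_leffler (real CARD('e) / 2 - 1) (real CARD('e) / 2 - 1)
                     (lam * t * (c\<^sup>2 * t\<^sup>2 - (norm y)\<^sup>2) powr (real CARD('e) / 2 - 1)
                        / (c * t) powr (real CARD('e) - 2))
                     / mittag_leffler (real CARD('e) / 2 - 1) (real CARD('e) / 2) (lam * t))
             else 0)))"
    unfolding exps
  proof (rule ac_component_flight[OF rf[unfolded second_flight_law_def] convolution_index_second])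
    show "(real n + 1) * (real CARD('e) / 2 - 1) + 1 = real CARD('e) / 2 + (real CARD('e) / 2 - 1) * real n" for n
      by (simp add: field_simps)
  qed (use assms d in auto)
qed

end
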